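(* Let $G$ be a finite solvable group such that every maximal subgroup $M$ of $G$ with $\pi(M)=\pi(G)$ is supersolvable. Then the $p$-length of $G$ is $1$ for every prime divisor $p$ of $|G|$.
   Context: For a finite group $X$, $\pi(X)$ denotes the set of all prime divisors of the order $|X|$. A finite group is supersolvable if all of its chief factors are cyclic of prime order. For a prime $p$, the $p$-length $l_p(G)$ of a finite solvable (more generally, $p$-solvable) group $G$ is the minimal number of factors that are $p$-groups in a normal series of $G$ each of whose factors is either a $p$-group or a $p'$-group (a group of order not divisible by $p$). *)

theory Defs
  imports "HOL-Algebra.Solvable_Groups" "HOL-Algebra.Elementary_Groups" "HOL-Computational_Algebra.Primes"
begin

definition prime_divisors_order :: "('a, 'b) monoid_scheme \<Rightarrow> nat set"
  where "prime_divisors_order X = {p. prime p \<and> p dvd order X}"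

definition maximal_subgroup :: "'a set \<Rightarrow> ('a, 'b) monoid_scheme \<Rightarrow> bool"
  where "maximal_subgroup M G \<longleftrightarrow>
    subgroup M G \<and> M \<noteq> carrier G \<and>
    (\<forall>L. subgroup L G \<longrightarrow> M \<subseteq> L \<longrightarrow> L = M \<or> L = carrier G)"

text \<open>The quotient of \<open>H\<close> by \<open>K\<close>, for subsets \<open>K \<subseteq> H\<close> of the carrier of \<open>G\<close>. It is a group
  whenever \<open>H\<close> is a subgroup of \<open>G\<close> and \<open>K\<close> is normal in \<open>H\<close>.\<close>

abbreviation section_of :: "('a, 'b) monoid_scheme \<Rightarrow> 'a set \<Rightarrow> 'a set \<Rightarrow> 'a set monoid"
  where "section_of G H K \<equiv> (G\<lparr>carrier := H\<rparr>) Mod K"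

definition chief_factor :: "('a, 'b) monoid_scheme \<Rightarrow> 'a set \<Rightarrow> 'a set \<Rightarrow> bool"
  where "chief_factor G H K \<longleftrightarrow>
    H \<lhd> G \<and> K \<lhd> G \<and> K \<subset> H \<and>
    (\<forall>L. L \<lhd> G \<longrightarrow> K \<subseteq> L \<longrightarrow> L \<subseteq> H \<longrightarrow> L = K \<or> L = H)"

text \<open>Finiteness is part of the notion here: an infinite group may have no chief factors at all.\<close>

definition supersolvable :: "('a, 'b) monoid_scheme \<Rightarrow> bool"
  where "supersolvable G \<longleftrightarrow>
    group G \<and> finite (carrier G) \<and>
    (\<forall>H K. chief_factor G H K \<longrightarrow>
      cyclic_group (section_of G H K) \<and> prime (order (section_of G H K)))"

text \<open>The trivial group is both a \<open>p\<close>-group and a \<open>p'\<close>-group. As \<open>order\<close> is 0 on infinite groups,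
  both predicates fail for these when \<open>p\<close> is prime.\<close>

definition p_group :: "nat \<Rightarrow> ('a, 'b) monoid_scheme \<Rightarrow> bool"
  where "p_group p X \<longleftrightarrow> group X \<and> (\<exists>k. order X = p ^ k)"

definition p'_group :: "nat \<Rightarrow> ('a, 'b) monoid_scheme \<Rightarrow> bool"
  where "p'_group p X \<longleftrightarrow> group X \<and> \<not> p dvd order X"

text \<open>A normal series is an ascending list \<open>1 = H\<^sub>0 \<subseteq> \<dots> \<subseteq> H\<^sub>n = G\<close> whose terms are all normal
  in \<open>G\<close> itself; repetitions are allowed.\<close>

definition normal_series :: "('a, 'b) monoid_scheme \<Rightarrow> 'a set list \<Rightarrow> bool"
  where "normal_series G Hs \<longleftrightarrow>
    Hs \<noteq> [] \<and> hd Hs = {\<one>\<^bsub>G\<^esub>} \<and> last Hs = carrier G \<and>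
    (\<forall>H \<in> set Hs. H \<lhd> G) \<and>
    (\<forall>i. Suc i < length Hs \<longrightarrow> Hs ! i \<subseteq> Hs ! Suc i)"

definition series_factor :: "('a, 'b) monoid_scheme \<Rightarrow> 'a set list \<Rightarrow> nat \<Rightarrow> 'a set monoid"
  where "series_factor G Hs i = section_of G (Hs ! Suc i) (Hs ! i)"

definition p_series :: "nat \<Rightarrow> ('a, 'b) monoid_scheme \<Rightarrow> 'a set list \<Rightarrow> bool"
  where "p_series p G Hs \<longleftrightarrow>
    normal_series G Hs \<and>
    (\<forall>i. Suc i < length Hs \<longrightarrow>
      p_group p (series_factor G Hs i) \<or> p'_group p (series_factor G Hs i))"

text \<open>Trivial factors count as \<open>p\<close>-groups; this does not affect the minimum, since they can be
  dropped from a series. The minimum is taken over a nonempty set exactly when \<open>G\<close> is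
  \<open>p\<close>-solvable.\<close>

definition p_length :: "nat \<Rightarrow> ('a, 'b) monoid_scheme \<Rightarrow> nat"
  where "p_length p G =
    (LEAST n. \<exists>Hs. p_series p G Hs \<and>
      n = card {i. Suc i < length Hs \<and> p_group p (series_factor G Hs i)})"

end

theory Submission
  imports Defs "HOL-Algebra.Sylow" "HOL-Algebra.Group_Action" "HOL-Algebra.SndIsomorphismGrp"
begin

text \<open>
  Let \<open>N\<^sub>0\<close> be a normal subgroup that is maximal with \<open>l\<^sub>p(G/N\<^sub>0) > 1\<close>, let \<open>N/N\<^sub>0\<close> be a chief factor, and read
  everything modulo \<open>N\<^sub>0\<close>. By maximality \<open>G\<close> has no nontrivial normal \<open>p'\<close>-subgroup, so \<open>N\<close> is an abelian
  \<open>p\<close>-group. As \<open>l\<^sub>p(G/N) \<le> 1 < l\<^sub>p(G)\<close>, there is a chief \<open>q\<close>-factor \<open>L/N\<close> with \<open>q \<noteq> p\<close>, and the Frattini argument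
  for a Sylow \<open>q\<close>-subgroup of \<open>L\<close> yields a complement \<open>M\<close> of \<open>N\<close>, which is a maximal subgroup. Two
  normal subgroups with trivial intersection would give \<open>l\<^sub>p(G) \<le> 1\<close>, so \<open>C\<^sub>G(N) = N\<close>. Now \<open>p\<close> divides
  \<open>|M| = |G : N|\<close>, hence \<open>\<pi>(M) = \<pi>(G)\<close> and \<open>M\<close> is supersolvable; likewise a maximal subgroup \<open>X \<supseteq> N\<close> of
  \<open>p\<close>-power index is supersolvable. In a supersolvable group the Sylow subgroup for the largest prime
  \<open>r\<close> is normal. If \<open>r \<noteq> p\<close>, the one of \<open>X\<close> centralizes \<open>N\<close>; if \<open>r = p\<close>, the one of \<open>M\<close> has nontrivial fixed points
  in \<open>N\<close>, and these form a normal subgroup of \<open>G\<close>, so it centralizes \<open>N\<close> as well. Both contradict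
  \<open>C\<^sub>G(N) = N\<close>.
\<close>

subsection \<open>Indices of subgroups\<close>

text \<open>The index \<open>|H : K|\<close>; meaningful only for finite subgroups \<open>K \<subseteq> H\<close>.\<close>

definition idx :: "'a set \<Rightarrow> 'a set \<Rightarrow> nat"
  where "idx H K = card H div card K"

locale finite_group = group +
  assumes finite_carrier: "finite (carrier G)"

lemma (in group) subgroup_finite_group:
  assumes "finite (carrier G)" "subgroup H G"
  shows "finite_group (G\<lparr>carrier := H\<rparr>)"
proof -
  interpret H: group "G\<lparr>carrier := H\<rparr>" using assms(2) subgroup_imp_group by blast
  show ?thesis
    by unfold_locales (simp add: finite_subset[OF subgroup.subset[OF assms(2)] assms(1)])
qed

lemma (in group) inv_cancel_left:
  assumes "x \<in> carrier G" "y \<in> carrier G"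
  shows "inv x \<otimes> (x \<otimes> y) = y" "x \<otimes> (inv x \<otimes> y) = y"
  using assms by (simp_all add: m_assoc[symmetric])

text \<open>Together with the default simplification rules these right-associate words, push
  inverses inward and cancel neighbouring inverse pairs, so that \<open>simp\<close> proves
  identities valid in every group.\<close>

lemmas (in group) word_simps = m_assoc inv_mult_group inv_cancel_left

lemma (in group) subgroup_nested_iff:
  assumes "subgroup H G"
  shows "subgroup K (G\<lparr>carrier := H\<rparr>) \<longleftrightarrow> subgroup K G \<and> K \<subseteq> H"
  using assms incl_subgroup[OF assms] subgroup.subset[of K "G\<lparr>carrier := H\<rparr>"] subgroup_incl[of K H]
  by auto

lemma (in group) normal_nested_iff:
  assumes H: "subgroup H G"
  shows "K \<lhd> (G\<lparr>carrier := H\<rparr>) \<longleftrightarrow>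
    subgroup K G \<and> K \<subseteq> H \<and> (\<forall>x\<in>H. \<forall>k\<in>K. x \<otimes> k \<otimes> inv x \<in> K)"
proof -
  interpret H: group "G\<lparr>carrier := H\<rparr>" using H subgroup_imp_group by blast
  show ?thesis
    unfolding H.normal_inv_iff subgroup_nested_iff[OF H]
    using m_inv_consistent[OF H] by auto
qed

context finite_group
begin

lemma finite_subgroup: "subgroup H G \<Longrightarrow> finite H"
  using finite_carrier finite_subset subgroup.subset by blast

lemma card_subgroup_pos: "subgroup H G \<Longrightarrow> card H > 0"
  using finite_subgroup[of H] subgroup.one_closed[of H G] by (auto simp: card_gt_0_iff)

lemma card_subgroup_dvd:
  assumes "subgroup H G" "subgroup K G" "K \<subseteq> H"
  shows "card K dvd card H"
proof -
  interpret H: group "G\<lparr>carrier := H\<rparr>" using assms subgroup_imp_group by blast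
  have "card (rcosets\<^bsub>G\<lparr>carrier := H\<rparr>\<^esub> K) * card K = card H"
    using H.lagrange[of K] assms subgroup_nested_iff[of H K] by (simp add: order_def)
  from this[symmetric] show ?thesis by simp
qed

lemma card_eq_idx:
  assumes "subgroup H G" "subgroup K G" "K \<subseteq> H"
  shows "card H = idx H K * card K"
  using card_subgroup_dvd[OF assms] by (simp add: idx_def)

lemma idx_pos:
  assumes "subgroup H G" "subgroup K G" "K \<subseteq> H"
  shows "idx H K > 0"
  using card_eq_idx[OF assms] card_subgroup_pos[OF assms(1)] by (metis mult_0 neq0_conv)

lemma idx_trans:
  assumes "subgroup H G" "subgroup K G" "subgroup L G" "K \<subseteq> H" "L \<subseteq> K"
  shows "idx H L = idx H K * idx K L"
proof -
  have "L \<subseteq> H" using assms by blast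
  then have "idx H L * card L = card H" using card_eq_idx[of H L] assms by simp
  also have "\<dots> = idx H K * card K" by (rule card_eq_idx) (use assms in auto)
  also have "card K = idx K L * card L" by (rule card_eq_idx) (use assms in auto)
  finally have "idx H L * card L = (idx H K * idx K L) * card L" by (simp only: mult.assoc)
  then show ?thesis using card_subgroup_pos[OF assms(3)] by simp
qed

lemma idx_self [simp]: "subgroup H G \<Longrightarrow> idx H H = 1"
  using card_subgroup_pos by (simp add: idx_def)

lemma idx_eq_1:
  assumes "subgroup H G" "subgroup K G" "K \<subseteq> H" "idx H K = 1"
  shows "H = K"
  using card_eq_idx[OF assms(1-3)] assms(4) card_subset_eq[OF finite_subgroup[OF assms(1)] assms(3)] by simp

lemma idx_gt_1:
  assumes "subgroup H G" "subgroup K G" "K \<subset> H"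
  shows "idx H K > 1"
  using idx_eq_1[of H K] idx_pos[of H K] assms by (cases "idx H K = 1") auto

lemma card_rcosets_subgroup:
  assumes "subgroup H G" "subgroup K G" "K \<subseteq> H"
  shows "card (rcosets\<^bsub>G\<lparr>carrier := H\<rparr>\<^esub> K) = idx H K"
proof -
  interpret H: group "G\<lparr>carrier := H\<rparr>" using assms subgroup_imp_group by blast
  have "card (rcosets\<^bsub>G\<lparr>carrier := H\<rparr>\<^esub> K) * card K = card H"
    using H.lagrange[of K] assms subgroup_nested_iff[of H K] by (simp add: order_def)
  from this[symmetric] show ?thesis using card_subgroup_pos[OF assms(2)] by (simp add: idx_def)
qed

lemma order_section:
  assumes "subgroup H G" "subgroup K G" "K \<subseteq> H"
  shows "order (section_of G H K) = idx H K"
  using card_rcosets_subgroup[OF assms] by (simp add: order_def FactGroup_def)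

text \<open>The second isomorphism theorem, read as a statement about indices.\<close>

lemma idx_set_mult:
  assumes N: "N \<lhd> G" and S: "subgroup S G"
  shows "subgroup (N <#> S) G" "N \<subseteq> N <#> S" "S \<subseteq> N <#> S" "idx (N <#> S) N = idx S (N \<inter> S)"
proof -
  interpret second_isomorphism_grp N G S
    using N S by (simp add: second_isomorphism_grp_def second_isomorphism_grp_axioms_def)
  show *: "subgroup (N <#> S) G" "N \<subseteq> N <#> S" "S \<subseteq> N <#> S"
    using normal_set_mult_subgroup H_contained_in_set_mult S_contained_in_set_mult by auto
  have NS: "subgroup (N \<inter> S) G" using S is_subgroup subgroups_Inter_pair by blast
  show "idx (N <#> S) N = idx S (N \<inter> S)"
    using iso_same_order[OF normal_intersection_quotient_isom]
      order_section[OF *(1) is_subgroup *(2)] order_section[OF S NS] by simp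
qed

lemma idx_dvd_of_inter:
  assumes N: "N \<lhd> G" and S: "subgroup S G" and A: "subgroup A G" "N \<subseteq> A" "S \<subseteq> A"
  shows "idx S (N \<inter> S) dvd idx A N"
proof -
  note * = idx_set_mult[OF N S]
  have "N <#> S \<subseteq> A" using A subgroup_mult_id[of A] mono_set_mult by blast
  then have "idx A N = idx A (N <#> S) * idx (N <#> S) N"
    using idx_trans A * normal_imp_subgroup[OF N] by blast
  then show ?thesis using * by simp
qed

text \<open>The index |S \<inter> N : K| divides both |S : K| and |N : K|.\<close>

lemma Int_eq_if_coprime_idx:
  assumes "subgroup S G" "subgroup N G" "subgroup K G" "K \<subseteq> S" "K \<subseteq> N" "coprime (idx S K) (idx N K)"
  shows "S \<inter> N = K"
proof -
  have SN: "subgroup (S \<inter> N) G" using assms subgroups_Inter_pair by blast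
  have "idx (S \<inter> N) K dvd idx S K" "idx (S \<inter> N) K dvd idx N K"
    using idx_trans[of S "S \<inter> N" K] idx_trans[of N "S \<inter> N" K] SN assms by auto
  then have "idx (S \<inter> N) K = 1" using assms(6) coprime_common_divisor_nat by auto
  then show ?thesis using idx_eq_1 SN assms by blast
qed

text \<open>Conjugation by \<open>g\<close> and by \<open>inv g\<close> are both demanded, which
  makes closure under inverses immediate for an arbitrary set \<open>R\<close>.\<close>

definition set_normalizer :: "'a set \<Rightarrow> 'a set"
  where "set_normalizer R = {g \<in> carrier G. \<forall>x\<in>R. g \<otimes> x \<otimes> inv g \<in> R \<and> inv g \<otimes> x \<otimes> g \<in> R}"

lemma set_normalizer_subgroup:
  assumes "R \<subseteq> carrier G" shows "subgroup (set_normalizer R) G"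
proof (rule subgroupI)
  show "set_normalizer R \<subseteq> carrier G" by (auto simp: set_normalizer_def)
  have "\<one> \<in> set_normalizer R" using assms by (auto simp: set_normalizer_def)
  then show "set_normalizer R \<noteq> {}" by blast
next
  fix a assume "a \<in> set_normalizer R" then show "inv a \<in> set_normalizer R" by (auto simp: set_normalizer_def)
next
  fix a b assume a: "a \<in> set_normalizer R" and b: "b \<in> set_normalizer R"
  then have ab: "a \<in> carrier G" "b \<in> carrier G" by (auto simp: set_normalizer_def)
  have "a \<otimes> b \<otimes> x \<otimes> inv (a \<otimes> b) \<in> R \<and> inv (a \<otimes> b) \<otimes> x \<otimes> (a \<otimes> b) \<in> R" if x: "x \<in> R" for x
  proof -
    have xc: "x \<in> carrier G" using x assms by blast
    have "a \<otimes> (b \<otimes> x \<otimes> inv b) \<otimes> inv a \<in> R" "inv b \<otimes> (inv a \<otimes> x \<otimes> a) \<otimes> b \<in> R"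
      using a b x by (auto simp: set_normalizer_def)
    then show ?thesis using ab xc by (simp add: word_simps)
  qed
  then show "a \<otimes> b \<in> set_normalizer R" using ab by (auto simp: set_normalizer_def)
qed

lemma subset_set_normalizer: "subgroup R G \<Longrightarrow> R \<subseteq> set_normalizer R"
  by (auto simp: set_normalizer_def subgroup.mem_carrier subgroup.m_closed subgroup.m_inv_closed)

lemma normal_if_set_normalizer:
  assumes "subgroup R G" "set_normalizer R = carrier G" shows "R \<lhd> G"
  using assms by (intro normal_invI) (auto simp: set_normalizer_def)

text \<open>Conjugation is injective, so it maps the finite set \<open>R\<close> onto itself as soon
  as it maps it into itself.\<close>

lemma set_normalizerI:
  assumes "subgroup R G" "g \<in> carrier G" "\<And>x. x \<in> R \<Longrightarrow> g \<otimes> x \<otimes> inv g \<in> R"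
  shows "g \<in> set_normalizer R"
proof -
  let ?f = "\<lambda>x. g \<otimes> x \<otimes> inv g"
  have R: "R \<subseteq> carrier G" "finite R" using assms subgroup.subset finite_subgroup by auto
  have "inj_on ?f R" using R assms(2) conjugation_is_inj[OF assms(2)] by (auto intro!: inj_onI simp: subset_iff)
  then have im: "?f ` R = R" using assms(3) R(2) endo_inj_surj[of R ?f] by blast
  have "inv g \<otimes> x \<otimes> g \<in> R" if x: "x \<in> R" for x
  proof -
    obtain y where y: "y \<in> R" "x = g \<otimes> y \<otimes> inv g" using im x by force
    then have "inv g \<otimes> x \<otimes> g = y" using R assms(2) by (simp add: word_simps subset_iff)
    then show ?thesis using y by simp
  qed
  then show ?thesis using assms by (auto simp: set_normalizer_def)
qed

end

subsection \<open>Actions of groups of prime power order\<close>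

lemma dvd_prime_power_imp:
  fixes p :: nat assumes "prime p" "d dvd p ^ k" "\<not> p dvd d" shows "d = 1"
proof -
  obtain i where "d = p ^ i" using assms divides_primepow_nat by blast
  then show ?thesis using assms(3) by (cases i) auto
qed

text \<open>The function \<open>act\<close> obeys the laws of an action only on \<open>P\<close> and
  \<open>E\<close>; its restriction \<open>act_bij\<close> supplies the extensional maps of which
  \<open>BijGroup\<close> consists.\<close>

locale p_action = finite_group +
  fixes P :: "'a set" and p k :: nat and E :: "'c set" and act :: "'a \<Rightarrow> 'c \<Rightarrow> 'c"
  assumes P: "subgroup P G" and card_P: "card P = p ^ k" and prime_p: "prime p"
    and finite_E: "finite E"
    and act_closed: "\<And>g x. g \<in> P \<Longrightarrow> x \<in> E \<Longrightarrow> act g x \<in> E"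
    and act_one: "\<And>x. x \<in> E \<Longrightarrow> act \<one> x = x"
    and act_mult: "\<And>g h x. g \<in> P \<Longrightarrow> h \<in> P \<Longrightarrow> x \<in> E \<Longrightarrow> act (g \<otimes> h) x = act g (act h x)"
begin

abbreviation "act_bij \<equiv> \<lambda>g. \<lambda>x\<in>E. act g x"

sublocale action: group_action "G\<lparr>carrier := P\<rparr>" E act_bij
  unfolding group_action_def group_hom_def group_hom_axioms_def
proof (intro conjI group_BijGroup)
  show "group (G\<lparr>carrier := P\<rparr>)" by (rule subgroup_imp_group[OF P])
  have inv: "inv g \<in> P" if "g \<in> P" for g using that by (rule subgroup.m_inv_closed[OF P])
  have l: "act (inv g) (act g x) = x" "act g (act (inv g) x) = x" if "g \<in> P" "x \<in> E" for g x
    using that inv[of g] subgroup.mem_carrier[OF P, of g]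
    by (simp_all add: act_mult[symmetric] act_one)
  have bij: "act_bij g \<in> Bij E" if "g \<in> P" for g
  proof -
    have "bij_betw (act_bij g) E E"
      by (rule bij_betwI[where g = "act (inv g)"]) (use that inv act_closed l in auto)
    then show ?thesis by (simp add: Bij_def)
  qed
  have "act_bij (g \<otimes> h) = compose E (act_bij g) (act_bij h)" if "g \<in> P" "h \<in> P" for g h
    using that act_mult act_closed by (auto simp: compose_def fun_eq_iff)
  then show "act_bij \<in> hom (G\<lparr>carrier := P\<rparr>) (BijGroup E)"
    using bij by (auto simp: hom_def BijGroup_def)
qed

lemma orbit_eq: "x \<in> E \<Longrightarrow> orbit (G\<lparr>carrier := P\<rparr>) act_bij x = (\<lambda>g. act g x) ` P"
  by (auto simp: orbit_def)

lemma mem_orbit: "x \<in> E \<Longrightarrow> x \<in> (\<lambda>g. act g x) ` P"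
  using act_one[of x] imageI[OF subgroup.one_closed[OF P], of "\<lambda>g. act g x"] by simp

lemma card_orbit_dvd:
  assumes "x \<in> E" shows "card ((\<lambda>g. act g x) ` P) dvd p ^ k"
proof -
  have "card ((\<lambda>g. act g x) ` P) * card (stabilizer (G\<lparr>carrier := P\<rparr>) act_bij x) = p ^ k"
    using action.orbit_stabilizer_theorem[OF assms] card_P
    unfolding orbit_eq[OF assms] by (simp add: order_def)
  from this[symmetric] show ?thesis by (rule dvdI)
qed

lemma fixed_if_small_orbit:
  assumes x: "x \<in> E" and small: "\<not> p dvd card ((\<lambda>g. act g x) ` P)" and g: "g \<in> P"
  shows "act g x = x"
proof -
  have "card ((\<lambda>g. act g x) ` P) = 1"
    using dvd_prime_power_imp[OF prime_p card_orbit_dvd[OF x] small] .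
  then obtain y where "(\<lambda>g. act g x) ` P = {y}" by (auto simp: card_1_singleton_iff)
  then show ?thesis using mem_orbit[OF x] g by auto
qed

text \<open>Orbit lengths divide a power of \<open>p\<close>. Without a fixed point all of them
  would be divisible by \<open>p\<close>, and so would their sum |E|.\<close>

lemma fixed_point:
  assumes "\<not> p dvd card E"
  shows "\<exists>x\<in>E. \<forall>g\<in>P. act g x = x"
proof (rule ccontr)
  assume nofix: "\<not> ?thesis"
  have "p dvd card Q" if Q: "Q \<in> orbits (G\<lparr>carrier := P\<rparr>) E act_bij" for Q
  proof -
    obtain x where "x \<in> E" "Q = (\<lambda>g. act g x) ` P"
      using Q orbit_eq by (auto simp: orbits_def)
    then show ?thesis using nofix fixed_if_small_orbit by blast
  qed
  then have "p dvd sum card (orbits (G\<lparr>carrier := P\<rparr>) E act_bij)" by (rule dvd_sum)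
  then show False using action.disjoint_sum[OF finite_E, of "\<lambda>_. 1::nat"] assms by simp
qed

text \<open>An orbit of fewer than \<open>p\<close> points has length prime to \<open>p\<close>,
  hence length 1.\<close>

lemma trivial_if_card_less:
  assumes "card E < p" "x \<in> E" "g \<in> P"
  shows "act g x = x"
proof (rule fixed_if_small_orbit[OF assms(2) _ assms(3)])
  have sub: "(\<lambda>g. act g x) ` P \<subseteq> E" using act_closed[OF _ assms(2)] by auto
  have "card ((\<lambda>g. act g x) ` P) < p" using card_mono[OF finite_E sub] assms(1) by simp
  moreover have "card ((\<lambda>g. act g x) ` P) > 0"
    using mem_orbit[OF assms(2)] finite_subset[OF sub finite_E] by (auto simp: card_gt_0_iff)
  ultimately show "\<not> p dvd card ((\<lambda>g. act g x) ` P)" using nat_dvd_not_less by blast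
qed

end

subsection \<open>Sylow subgroups and the Frattini argument\<close>

context finite_group
begin

text \<open>\<open>P\<close> acts on the right cosets of \<open>S\<close>; multiplying by the
  inverse makes this a left action. The number of cosets is prime to \<open>p\<close>, so some coset
  \<open>S #> x\<close> is fixed, which means that \<open>x\<close> conjugates \<open>P\<close> into
  \<open>S\<close>.\<close>

lemma sylow_conjugate:
  assumes p: "prime p" and P: "subgroup P G" "card P = p ^ k"
    and S: "subgroup S G" "\<not> p dvd idx (carrier G) S"
  shows "\<exists>x\<in>carrier G. \<forall>g\<in>P. x \<otimes> g \<otimes> inv x \<in> S"
proof -
  have Sc: "S \<subseteq> carrier G" using S(1) subgroup.subset by blast
  have Pc: "g \<in> carrier G" if "g \<in> P" for g using P(1) that by (rule subgroup.mem_carrier)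
  have E: "\<exists>a\<in>carrier G. C = S #> a" if "C \<in> rcosets S" for C
    using that by (auto simp: RCOSETS_def)
  have Cc: "C \<subseteq> carrier G" if "C \<in> rcosets S" for C
    using subgroup.rcosets_carrier[OF S(1) is_group that] .
  interpret p_action G P p k "rcosets S" "\<lambda>g C. C #> inv g"
  proof unfold_locales
    show "finite (rcosets S)"
      using finite_subset[OF rcosets_subset_PowG[OF S(1)]] finite_carrier by simp
    show "C #> inv g \<in> rcosets S" if g: "g \<in> P" and C: "C \<in> rcosets S" for g C
    proof -
      obtain a where a: "a \<in> carrier G" "C = S #> a" using E[OF C] by blast
      have "S #> (a \<otimes> inv g) \<in> rcosets S" by (rule rcosetsI) (use Sc a Pc[OF g] in auto)
      then show ?thesis using a Pc[OF g] Sc by (simp add: coset_mult_assoc)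
    qed
    show "C #> inv \<one> = C" if "C \<in> rcosets S" for C
      using Cc[OF that] by simp
    show "C #> inv (g \<otimes> h) = C #> inv h #> inv g" if "g \<in> P" "h \<in> P" "C \<in> rcosets S" for g h C
      using Pc that Cc by (simp add: inv_mult_group coset_mult_assoc)
  qed (use P p in \<open>auto simp: subgroup_def subset_iff\<close>)
  have "card (rcosets S) = idx (carrier G) S"
    using card_rcosets_subgroup[OF subgroup_self S(1) Sc] by simp
  then obtain C where C: "C \<in> rcosets S" "\<forall>g\<in>P. C #> inv g = C"
    using fixed_point S(2) by auto
  then obtain x where x: "x \<in> carrier G" "C = S #> x" using E by blast
  have "x \<otimes> g \<otimes> inv x \<in> S" if g: "g \<in> P" for g
  proof -
    have "C #> inv (inv g) = C" using C(2) subgroup.m_inv_closed[OF P(1) g] by blast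
    then have "S #> (x \<otimes> g) = S #> x" using x Sc Pc[OF g] by (simp add: coset_mult_assoc)
    then have "S #> (x \<otimes> g \<otimes> inv x) = S" using coset_mult_inv2 x Sc Pc[OF g] by simp
    then show ?thesis using coset_join1 S(1) x Pc[OF g] by blast
  qed
  then show ?thesis using x by blast
qed

lemma sylow_conjugate_in:
  assumes p: "prime p" and P: "subgroup P G" "P \<subseteq> D" "card P = p ^ k"
    and S: "subgroup S G" "S \<subseteq> D" "\<not> p dvd idx D S" and D: "subgroup D G"
  shows "\<exists>x\<in>D. \<forall>g\<in>P. x \<otimes> g \<otimes> inv x \<in> S"
proof -
  interpret D: finite_group "G\<lparr>carrier := D\<rparr>"
    using subgroup_finite_group[OF finite_carrier D] .
  show ?thesis
    using D.sylow_conjugate[OF p, of P k S] P S subgroup_nested_iff[OF D] m_inv_consistent[OF D] by auto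
qed

text \<open>The Sylow property is recorded by the index. If \<open>r\<close> does not divide |H|,
  then \<open>S\<close> is trivial.\<close>

lemma sylow_exists:
  assumes r: "prime r" and H: "subgroup H G"
  obtains S k where "subgroup S G" "S \<subseteq> H" "card S = r ^ k" "\<not> r dvd idx H S"
proof -
  interpret H: finite_group "G\<lparr>carrier := H\<rparr>"
    using subgroup_finite_group[OF finite_carrier H] .
  define a where "a = multiplicity r (card H)"
  obtain m where m: "card H = r ^ a * m" "\<not> r dvd m"
    using multiplicity_decompose'[of "card H" r] card_subgroup_pos[OF H] r not_prime_unit
    unfolding a_def by (metis neq0_conv)
  obtain S where S: "subgroup S (G\<lparr>carrier := H\<rparr>)" "card S = r ^ a"
    using sylow_thm[OF r H.is_group, of a m] m H.finite_carrier by (auto simp: order_def)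
  moreover have "idx H S = m"
    using S(2) m r prime_gt_0_nat[OF r] by (simp add: idx_def)
  ultimately show thesis using that subgroup_nested_iff[OF H] m by auto
qed

lemma conjugate_subgroup:
  assumes S: "subgroup S G" and g: "g \<in> carrier G"
  shows "subgroup ((\<lambda>s. g \<otimes> s \<otimes> inv g) ` S) G" "card ((\<lambda>s. g \<otimes> s \<otimes> inv g) ` S) = card S"
proof -
  have Sc: "s \<in> carrier G" if "s \<in> S" for s using S that by (rule subgroup.mem_carrier)
  show "subgroup ((\<lambda>s. g \<otimes> s \<otimes> inv g) ` S) G"
  proof (rule subgroupI)
    show "(\<lambda>s. g \<otimes> s \<otimes> inv g) ` S \<subseteq> carrier G" using Sc g by auto
    show "(\<lambda>s. g \<otimes> s \<otimes> inv g) ` S \<noteq> {}" using subgroup.one_closed[OF S] by blast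
  next
    fix a assume "a \<in> (\<lambda>s. g \<otimes> s \<otimes> inv g) ` S"
    then obtain s where s: "s \<in> S" "a = g \<otimes> s \<otimes> inv g" by blast
    then have "inv a = g \<otimes> inv s \<otimes> inv g" using Sc g by (simp add: word_simps)
    then show "inv a \<in> (\<lambda>s. g \<otimes> s \<otimes> inv g) ` S" using subgroup.m_inv_closed[OF S s(1)] by blast
  next
    fix a b assume "a \<in> (\<lambda>s. g \<otimes> s \<otimes> inv g) ` S" "b \<in> (\<lambda>s. g \<otimes> s \<otimes> inv g) ` S"
    then obtain s t where s: "s \<in> S" "a = g \<otimes> s \<otimes> inv g" "t \<in> S" "b = g \<otimes> t \<otimes> inv g" by blast
    then have "a \<otimes> b = g \<otimes> (s \<otimes> t) \<otimes> inv g" using Sc g by (simp add: word_simps)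
    then show "a \<otimes> b \<in> (\<lambda>s. g \<otimes> s \<otimes> inv g) ` S" using subgroup.m_closed[OF S s(1,3)] by blast
  qed
  have "inj_on (\<lambda>s. g \<otimes> s \<otimes> inv g) S"
    using conjugation_is_inj[OF g] Sc by (auto intro!: inj_onI)
  then show "card ((\<lambda>s. g \<otimes> s \<otimes> inv g) ` S) = card S" by (rule card_image)
qed

text \<open>The conjugate of \<open>S\<close> by \<open>g\<close> lies in \<open>D\<close> again, so
  some \<open>x\<close> in \<open>D\<close> conjugates it back into \<open>S\<close>. Then
  \<open>x \<otimes> g\<close> normalizes \<open>S\<close>, and also \<open>K <#> S\<close> because
  \<open>K\<close> is normal.\<close>

lemma frattini:
  assumes K: "K \<lhd> G" and D: "D \<lhd> G" and q: "prime q"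
    and S: "subgroup S G" "S \<subseteq> D" "card S = q ^ k" "\<not> q dvd idx D S" and g: "g \<in> carrier G"
  shows "\<exists>x\<in>D. x \<otimes> g \<in> set_normalizer (K <#> S)"
proof -
  let ?P = "(\<lambda>s. g \<otimes> s \<otimes> inv g) ` S"
  have D': "subgroup D G" using D normal_imp_subgroup by blast
  have Sc: "s \<in> carrier G" if "s \<in> S" for s using S(1) that by (rule subgroup.mem_carrier)
  have Dc: "d \<in> carrier G" if "d \<in> D" for d using D' that by (rule subgroup.mem_carrier)
  have Kc: "d \<in> carrier G" if "d \<in> K" for d
    using normal_imp_subgroup[OF K] that by (rule subgroup.mem_carrier)
  have "?P \<subseteq> D" using S(2) normal_invE(2)[OF D g] by blast
  then obtain x where x: "x \<in> D" "\<forall>y\<in>?P. x \<otimes> y \<otimes> inv x \<in> S"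
    using sylow_conjugate_in[OF q conjugate_subgroup(1)[OF S(1) g] _ _ S(1,2,4) D', of k]
      conjugate_subgroup(2)[OF S(1) g] S(3) by auto
  let ?h = "x \<otimes> g"
  have h: "?h \<in> carrier G" using x Dc g by simp
  have hS: "?h \<otimes> s \<otimes> inv ?h \<in> S" if s: "s \<in> S" for s
  proof -
    have "x \<otimes> (g \<otimes> s \<otimes> inv g) \<otimes> inv x \<in> S" using x s by blast
    then show ?thesis using g Dc[OF x(1)] Sc[OF s] by (simp add: word_simps)
  qed
  have "?h \<in> set_normalizer (K <#> S)"
  proof (rule set_normalizerI[OF idx_set_mult(1)[OF K S(1)] h])
    fix y assume "y \<in> K <#> S"
    then obtain n s where n: "n \<in> K" "s \<in> S" "y = n \<otimes> s" by (auto simp: set_mult_def)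
    then have "?h \<otimes> y \<otimes> inv ?h = (?h \<otimes> n \<otimes> inv ?h) \<otimes> (?h \<otimes> s \<otimes> inv ?h)"
      using g Dc[OF x(1)] Sc Kc by (simp add: word_simps)
    then show "?h \<otimes> y \<otimes> inv ?h \<in> K <#> S"
      using hS[OF n(2)] normal_invE(2)[OF K h n(1)] by (auto simp: set_mult_def)
  qed
  then show ?thesis using x(1) by blast
qed

text \<open>The Frattini argument gives a factorization with first factor \<open>D\<close>. As
  \<open>S\<close> lies in the normalizer of \<open>K <#> S\<close>, the part of \<open>D\<close>
  coming from \<open>S\<close> is absorbed there and \<open>B\<close> remains.\<close>

lemma frattini_product:
  assumes K: "K \<lhd> G" and B: "B \<lhd> G" and D: "D \<lhd> G" and q: "prime q"
    and S: "subgroup S G" "S \<subseteq> D" "card S = q ^ k" "\<not> q dvd idx D S" and DBS: "D \<subseteq> B <#> S"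
  shows "carrier G = B <#> set_normalizer (K <#> S)"
proof
  have N: "subgroup (set_normalizer (K <#> S)) G"
    using set_normalizer_subgroup subgroup.subset[OF idx_set_mult(1)[OF K S(1)]] by blast
  have Bs: "subgroup B G" using B normal_imp_subgroup by blast
  show "B <#> set_normalizer (K <#> S) \<subseteq> carrier G"
    using setmult_subset_G subgroup.subset[OF Bs] subgroup.subset[OF N] by blast
  show "carrier G \<subseteq> B <#> set_normalizer (K <#> S)"
  proof
    fix g assume g: "g \<in> carrier G"
    obtain x where x: "x \<in> D" "x \<otimes> g \<in> set_normalizer (K <#> S)" using frattini[OF K D q S g] by blast
    have xc: "x \<in> carrier G" using x(1) subgroup.mem_carrier[OF normal_imp_subgroup[OF D]] by blast
    have "inv x \<in> D" using subgroup.m_inv_closed[OF normal_imp_subgroup[OF D] x(1)] .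
    then obtain b s where b: "b \<in> B" "s \<in> S" "inv x = b \<otimes> s"
      using DBS by (auto simp: set_mult_def)
    have c: "b \<in> carrier G" "s \<in> carrier G"
      using b subgroup.mem_carrier[OF Bs] subgroup.mem_carrier[OF S(1)] by auto
    have "s \<in> set_normalizer (K <#> S)"
      using b(2) idx_set_mult(1,3)[OF K S(1)] subset_set_normalizer by blast
    then have m: "s \<otimes> (x \<otimes> g) \<in> set_normalizer (K <#> S)" using subgroup.m_closed[OF N _ x(2)] by blast
    have "g = inv x \<otimes> (x \<otimes> g)" using xc g by (simp add: word_simps)
    also have "\<dots> = b \<otimes> (s \<otimes> (x \<otimes> g))" using b(3) c xc g by (simp add: m_assoc)
    finally show "g \<in> B <#> set_normalizer (K <#> S)" using b(1) m by (auto simp: set_mult_def)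
  qed
qed

text \<open>Compute |G : B \<inter> X| once through \<open>X\<close> and once through
  \<open>B\<close>, then cancel |G : B| = |X : B \<inter> X|.\<close>

lemma idx_supplement:
  assumes B: "B \<lhd> G" and X: "subgroup X G" and G: "carrier G = B <#> X"
  shows "idx (carrier G) X = idx B (B \<inter> X)"
proof -
  have Bs: "subgroup B G" using B normal_imp_subgroup by blast
  note s = Bs X subgroups_Inter_pair[OF Bs X] subgroup_self subgroup.subset[OF Bs] subgroup.subset[OF X]
  have "idx (carrier G) X * idx X (B \<inter> X) = idx (carrier G) (B \<inter> X)"
    by (rule idx_trans[symmetric]) (use s in auto)
  also have "\<dots> = idx (carrier G) B * idx B (B \<inter> X)"
    by (rule idx_trans) (use s in auto)
  also have "idx (carrier G) B = idx X (B \<inter> X)" using idx_set_mult(4)[OF B X] G by simp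
  finally show ?thesis using idx_pos[OF X subgroups_Inter_pair[OF Bs X]] by simp
qed

subsection \<open>Chief factors of solvable groups\<close>

lemma chief_factorD:
  assumes "chief_factor G H K"
  shows "H \<lhd> G" "K \<lhd> G" "K \<subset> H" "subgroup H G" "subgroup K G" "K \<subseteq> H"
    "\<And>L. L \<lhd> G \<Longrightarrow> K \<subseteq> L \<Longrightarrow> L \<subseteq> H \<Longrightarrow> L = K \<or> L = H"
  using assms normal_imp_subgroup unfolding chief_factor_def by auto

lemma chief_factor_exists:
  assumes K: "K \<lhd> G" and L: "L \<lhd> G" and KL: "K \<subset> L"
  obtains H where "chief_factor G H K" "H \<subseteq> L"
proof -
  let ?P = "\<lambda>H. H \<lhd> G \<and> K \<subset> H \<and> H \<subseteq> L"
  obtain H where H: "?P H" "\<And>H'. ?P H' \<Longrightarrow> card H \<le> card H'"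
    using ex_has_least_nat[of ?P L card] L KL by blast
  have "L' = K \<or> L' = H" if L': "L' \<lhd> G" "K \<subseteq> L'" "L' \<subseteq> H" for L'
  proof (rule ccontr)
    assume "\<not> ?thesis"
    then have "?P L'" "L' \<subset> H" using L' H(1) by auto
    then show False
      using H psubset_card_mono[OF finite_subgroup[OF normal_imp_subgroup]] by (meson leD)
  qed
  then show thesis using that H(1) K by (auto simp: chief_factor_def)
qed

lemma set_mult_subset:
  assumes D: "subgroup D G" and "A \<subseteq> D" "B \<subseteq> D"
  shows "A <#> B \<subseteq> D"
  using mono_set_mult[OF assms(2,3), of G] subgroup_mult_id[OF D] by simp

lemma derived_series_normal: "(derived G ^^ i) (carrier G) \<lhd> G"
  by (induction i) (use derived_is_normal normal_self in auto)

lemma normal_set_mult: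
  assumes "K \<lhd> G" "S \<lhd> G" shows "K <#> S \<lhd> G" "K \<subseteq> K <#> S" "S \<subseteq> K <#> S"
  using assms normal_subgroup_set_mult_closed idx_set_mult[OF assms(1) normal_imp_subgroup[OF assms(2)]]
  by auto

lemma commutator_in_normal_mult:
  assumes E: "E \<lhd> G" and k: "k1 \<in> E" "k2 \<in> E" and d: "d1 \<in> carrier G" "d2 \<in> carrier G"
    and c: "d1 \<otimes> d2 \<otimes> inv d1 \<otimes> inv d2 \<in> E"
  shows "(k1 \<otimes> d1) \<otimes> (k2 \<otimes> d2) \<otimes> inv (k1 \<otimes> d1) \<otimes> inv (k2 \<otimes> d2) \<in> E"
proof -
  interpret E: normal E G by (fact E)
  note k' = k[THEN E.mem_carrier]
  define e where "e = d1 \<otimes> d2 \<otimes> inv d1"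
  have e: "e \<in> carrier G" using d by (simp add: e_def)
  have "d1 \<otimes> k2 \<otimes> inv d1 \<in> E" "e \<otimes> inv k1 \<otimes> inv e \<in> E" "inv k2 \<in> E"
    using E.inv_op_closed2[OF d(1) k(2)] E.inv_op_closed2[OF e E.m_inv_closed[OF k(1)]]
      E.m_inv_closed[OF k(2)] by auto
  \<comment> \<open>The product of these five elements of \<open>E\<close> is the commutator of
    \<open>k1 \<otimes> d1\<close> and \<open>k2 \<otimes> d2\<close>.\<close>
  then have "k1 \<otimes> (d1 \<otimes> k2 \<otimes> inv d1) \<otimes> (e \<otimes> inv k1 \<otimes> inv e)
      \<otimes> (d1 \<otimes> d2 \<otimes> inv d1 \<otimes> inv d2) \<otimes> inv k2 \<in> E"
    using k(1) c by (simp only: E.m_closed)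
  then show ?thesis using k' d unfolding e_def by (simp add: word_simps)
qed

text \<open>Chief factors of a solvable group are abelian. Choose the last derived subgroup
  \<open>D i\<close> with \<open>H\<close> contained in \<open>K <#> D i\<close>. By the chief
  property \<open>H\<close> meets \<open>K <#> D (Suc i)\<close> exactly in \<open>K\<close>, and
  commutators of elements of \<open>H\<close> lie in this intersection.\<close>

lemma chief_factor_commutator:
  assumes sol: "solvable G" and ch: "chief_factor G H K" and ab: "a \<in> H" "b \<in> H"
  shows "a \<otimes> b \<otimes> inv a \<otimes> inv b \<in> K"
proof -
  note c = chief_factorD[OF ch]
  define D where "D i = (derived G ^^ i) (carrier G)" for i
  have Dn: "D i \<lhd> G" for i using derived_series_normal by (simp add: D_def)
  obtain n where n: "D n = {\<one>}"
    using sol solvable_iff_trivial_derived_seq by (auto simp: D_def)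
  have "K <#> D n = K"
    using subgroup.subset[OF c(5)] by (auto simp: n set_mult_def subset_iff)
  then have "\<not> H \<subseteq> K <#> D n" using c(3) by blast
  moreover have "H \<subseteq> K <#> D 0"
    using normal_set_mult(3)[OF c(2) Dn[of 0]] subgroup.subset[OF c(4)] by (auto simp: D_def)
  ultimately obtain i where i: "H \<subseteq> K <#> D i" "\<not> H \<subseteq> K <#> D (Suc i)"
    using nat_induct[of "\<lambda>i. H \<subseteq> K <#> D i" n] by blast
  let ?E = "K <#> D (Suc i)"
  note E = normal_set_mult[OF c(2) Dn[of "Suc i"]]
  have "H \<inter> ?E = K \<or> H \<inter> ?E = H"
    using c(7)[OF normal_subgroup_intersect[OF c(1) E(1)]] c(6) E(2) by blast
  then have HE: "H \<inter> ?E = K" using i(2) by blast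
  obtain k1 d1 k2 d2 where k: "k1 \<in> K" "d1 \<in> D i" "a = k1 \<otimes> d1" "k2 \<in> K" "d2 \<in> D i" "b = k2 \<otimes> d2"
    using ab i(1) by (auto simp: set_mult_def subset_iff) metis
  have dc: "d1 \<in> carrier G" "d2 \<in> carrier G"
    using k subgroup.mem_carrier[OF normal_imp_subgroup[OF Dn]] by auto
  have "d1 \<otimes> d2 \<otimes> inv d1 \<otimes> inv d2 \<in> derived G (D i)"
    unfolding derived_def by (rule generate.incl) (use k in blast)
  then have "d1 \<otimes> d2 \<otimes> inv d1 \<otimes> inv d2 \<in> ?E" using E(3) by (auto simp: D_def)
  then have "a \<otimes> b \<otimes> inv a \<otimes> inv b \<in> ?E"
    using commutator_in_normal_mult[OF E(1) _ _ dc] k E(2) by blast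
  moreover have "a \<otimes> b \<otimes> inv a \<otimes> inv b \<in> H"
    using ab c(4) by (simp add: subgroup.m_closed subgroup.m_inv_closed)
  ultimately show ?thesis using HE by blast
qed

lemma normalizes_between:
  assumes K: "subgroup K G" and R: "subgroup R G" and KR: "K \<subseteq> R"
    and h: "h \<in> carrier G" "\<And>x. x \<in> R \<Longrightarrow> h \<otimes> x \<otimes> inv h \<otimes> inv x \<in> K"
  shows "h \<in> set_normalizer R"
proof (rule set_normalizerI[OF R h(1)])
  fix x assume x: "x \<in> R"
  have "(h \<otimes> x \<otimes> inv h \<otimes> inv x) \<otimes> x \<in> R" using h(2)[OF x] KR x subgroup.m_closed[OF R] by blast
  then show "h \<otimes> x \<otimes> inv h \<in> R"
    using h(1) subgroup.mem_carrier[OF R x] by (simp add: word_simps)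
qed

lemma chief_factor_subset_set_normalizer:
  assumes "solvable G" "chief_factor G H K" "subgroup R G" "K \<subseteq> R" "R \<subseteq> H"
  shows "H \<subseteq> set_normalizer R"
proof
  fix h assume h: "h \<in> H"
  note c = chief_factorD[OF assms(2)]
  show "h \<in> set_normalizer R"
    using normalizes_between[OF c(5) assms(3,4) subgroup.mem_carrier[OF c(4) h]]
      chief_factor_commutator[OF assms(1,2) h] assms(5) by blast
qed

lemma set_mult_supplement_mono:
  assumes "subgroup H G" "subgroup X G" "H \<subseteq> X" "carrier G = H <#> X"
  shows "X = carrier G"
  using assms set_mult_subset[of X H X] subgroup.subset[of X G] by blast

lemma normal_if_supplement:
  assumes H: "subgroup H G" and X: "subgroup X G" and G: "carrier G = H <#> X"
    and R: "subgroup R G" "H \<subseteq> set_normalizer R" "X \<subseteq> set_normalizer R"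
  shows "R \<lhd> G"
proof (rule normal_if_set_normalizer[OF R(1)])
  have N: "subgroup (set_normalizer R) G" using set_normalizer_subgroup subgroup.subset[OF R(1)] by blast
  have "H <#> X \<subseteq> set_normalizer R" using set_mult_subset[OF N R(2,3)] .
  then show "set_normalizer R = carrier G" using G subgroup.subset[OF N] by blast
qed

text \<open>\<open>H \<inter> X\<close> is normalized by \<open>H\<close>, since H/K is abelian, and
  by \<open>X\<close>, so it is normal in \<open>G\<close>. It cannot be \<open>H\<close>, because
  \<open>H \<subseteq> X\<close> would force \<open>X\<close> to be the whole group.\<close>

lemma chief_factor_supplement:
  assumes sol: "solvable G" and ch: "chief_factor G H K" and X: "subgroup X G" "K \<subseteq> X" "X \<noteq> carrier G"
    and G: "carrier G = H <#> X"
  shows "H \<inter> X = K"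
proof -
  note c = chief_factorD[OF ch]
  have HX: "subgroup (H \<inter> X) G" "K \<subseteq> H \<inter> X" using subgroups_Inter_pair c X by auto
  have "X \<subseteq> set_normalizer (H \<inter> X)"
  proof
    fix x assume x: "x \<in> X"
    have xc: "x \<in> carrier G" using subgroup.mem_carrier[OF X(1) x] .
    show "x \<in> set_normalizer (H \<inter> X)"
      by (rule set_normalizerI[OF HX(1) xc])
         (use normal_invE(2)[OF c(1) xc] subgroup.m_closed[OF X(1)] x subgroup.m_inv_closed[OF X(1) x] in auto)
  qed
  then have "H \<inter> X \<lhd> G"
    using normal_if_supplement[OF c(4) X(1) G HX(1)] chief_factor_subset_set_normalizer[OF sol ch HX] by blast
  then have "H \<inter> X = K \<or> H \<inter> X = H" using c(7) HX(2) by blast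
  moreover have "H \<inter> X \<noteq> H" using set_mult_supplement_mono[OF c(4) X(1) _ G] X(3) by blast
  ultimately show ?thesis by blast
qed

lemma dvd_prime_powerE:
  fixes p :: nat assumes "prime p" "d dvd p ^ k" obtains i where "d = p ^ i"
  using assms divides_primepow_nat by blast

text \<open>|D : BS| divides the \<open>q\<close>-power |D : B| and also |D : S|, which is prime to
  \<open>q\<close>.\<close>

lemma sylow_mult_eq:
  assumes B: "B \<lhd> G" and D: "subgroup D G" "B \<subseteq> D" and q: "prime q"
    and S: "subgroup S G" "S \<subseteq> D" "\<not> q dvd idx D S" and D': "idx D B = q ^ n"
  shows "B <#> S = D"
proof -
  note s = idx_set_mult[OF B S(1)]
  have BS: "B <#> S \<subseteq> D" using set_mult_subset[OF D S(2)] .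
  have "idx D B = idx D (B <#> S) * idx (B <#> S) B" "idx D S = idx D (B <#> S) * idx (B <#> S) S"
    using idx_trans[OF D(1) s(1) normal_imp_subgroup[OF B] BS s(2)]
      idx_trans[OF D(1) s(1) S(1) BS s(3)] by simp_all
  then have "idx D (B <#> S) dvd q ^ n" "\<not> q dvd idx D (B <#> S)" using D' S(3) by (auto intro: dvdI)
  then have "idx D (B <#> S) = 1" using dvd_prime_power_imp[OF q] by blast
  then show ?thesis using idx_eq_1[OF D(1) s(1) BS] by blast
qed

text \<open>For a Sylow \<open>r\<close>-subgroup \<open>S\<close> of \<open>H\<close>, the group
  \<open>K <#> S\<close> is normalized by \<open>H\<close>, as H/K is abelian. The Frattini argument
  then makes it normal in \<open>G\<close>, and by the choice of \<open>r\<close> it is not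
  \<open>K\<close>, so it is \<open>H\<close>.\<close>

lemma chief_factor_prime_power:
  assumes sol: "solvable G" and ch: "chief_factor G H K"
  obtains r n where "prime r" "n > 0" "idx H K = r ^ n"
proof -
  note c = chief_factorD[OF ch]
  have "idx H K \<noteq> 1" using idx_gt_1[OF c(4,5,3)] by simp
  then obtain r where r: "prime r" "r dvd idx H K" using prime_factor_nat by blast
  obtain S k where S: "subgroup S G" "S \<subseteq> H" "card S = r ^ k" "\<not> r dvd idx H S"
    using sylow_exists[OF r(1) c(4)] .
  let ?R = "K <#> S"
  note s = idx_set_mult[OF c(2) S(1)]
  have RH: "?R \<subseteq> H" using set_mult_subset[OF c(4,6) S(2)] .
  have HN: "H \<subseteq> set_normalizer ?R" using chief_factor_subset_set_normalizer[OF sol ch s(1,2) RH] .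
  have "H \<subseteq> H <#> S" using idx_set_mult(2)[OF c(1) S(1)] .
  then have "carrier G = H <#> set_normalizer ?R" using frattini_product[OF c(2,1,1) r(1) S] by blast
  then have "set_normalizer ?R = carrier G"
    using set_mult_supplement_mono[OF c(4) set_normalizer_subgroup HN] subgroup.subset[OF s(1)] by blast
  then have "?R = K \<or> ?R = H" using c(7)[OF normal_if_set_normalizer[OF s(1)]] s(2) RH by blast
  moreover have "?R \<noteq> K"
  proof
    assume "?R = K"
    then have "idx H S = idx H K * idx K S"
      using idx_trans[OF c(4,5) S(1) c(6)] s(3) by simp
    then show False using S(4) r(2) by simp
  qed
  ultimately have "idx H K = idx S (K \<inter> S)" using s(4) by auto
  moreover have "idx S (K \<inter> S) dvd r ^ k"
    using card_eq_idx[OF S(1) subgroups_Inter_pair[OF c(5) S(1)]] S(3) by (metis dvd_triv_left inf_le2)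
  ultimately obtain n where n: "idx H K = r ^ n" using dvd_prime_powerE[OF r(1)] by metis
  then have "n > 0" using \<open>idx H K \<noteq> 1\<close> by (cases n) auto
  then show thesis using that r n by blast
qed

lemma card_subgroup_less:
  assumes "subgroup M G" shows "card M < Suc (card (carrier G))"
  using card_mono[OF finite_carrier subgroup.subset[OF assms]] by simp

lemma maximal_subgroup_exists:
  assumes X: "subgroup X G" "X \<noteq> carrier G"
  obtains M where "maximal_subgroup M G" "X \<subseteq> M"
proof -
  let ?P = "\<lambda>M. subgroup M G \<and> M \<noteq> carrier G \<and> X \<subseteq> M"
  have "?P X" "\<forall>M. ?P M \<longrightarrow> card M < Suc (card (carrier G))"
    using X card_subgroup_less by auto
  from ex_has_greatest_nat[of ?P, OF this]
  obtain M where M: "?P M" "\<And>M'. ?P M' \<Longrightarrow> card M' \<le> card M" by blast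
  have "L = M \<or> L = carrier G" if L: "subgroup L G" "M \<subseteq> L" for L
    using M L card_seteq[OF finite_subgroup[OF L(1)] L(2)] by blast
  then show thesis using that M(1) by (auto simp: maximal_subgroup_def)
qed

text \<open>A chief \<open>q\<close>-factor on top of a chief \<open>p\<close>-factor either can be moved below it or yields,
  by the Frattini argument, a proper supplement of the \<open>p\<close>-factor.\<close>

lemma chief_factor_dichotomy:
  assumes sol: "solvable G" and BC: "chief_factor G B C" and DB: "chief_factor G D B"
    and p: "prime p" "idx B C = p ^ m" and q: "prime q" "idx D B = q ^ n" "q \<noteq> p"
  obtains R where "subgroup R G" "C \<subset> R" "idx R C = q ^ n"
    "R \<lhd> G \<or> subgroup (set_normalizer R) G \<and> set_normalizer R \<noteq> carrier G \<and> C \<subseteq> set_normalizer R \<and> carrier G = B <#> set_normalizer R"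
proof -
  note b = chief_factorD[OF BC] and d = chief_factorD[OF DB]
  obtain S k where S: "subgroup S G" "S \<subseteq> D" "card S = q ^ k" "\<not> q dvd idx D S"
    using sylow_exists[OF q(1) d(4)] .
  have BS: "B <#> S = D" using sylow_mult_eq[OF b(1) d(4,6) q(1) S(1,2,4) q(2)] .
  let ?R = "C <#> S"
  note s = idx_set_mult[OF b(2) S(1)]
  have "idx S (C \<inter> S) dvd q ^ k"
    using card_eq_idx[OF S(1) subgroups_Inter_pair[OF b(5) S(1)]] S(3) by (metis dvd_triv_left inf_le2)
  then obtain j where j: "idx ?R C = q ^ j" using s(4) dvd_prime_powerE[OF q(1)] by metis
  have "coprime (idx B C) (idx ?R C)"
    unfolding p(2) j using primes_coprime[OF p(1) q(1)] q(3) by simp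
  then have BR: "B \<inter> ?R = C" using Int_eq_if_coprime_idx[OF b(4) s(1) b(5,6) s(2)] by blast
  have "B <#> S \<subseteq> B <#> ?R" using mono_set_mult[of B B S ?R] s(3) by blast
  moreover have "B <#> ?R \<subseteq> D"
    using set_mult_subset[OF d(4,6)] set_mult_subset[OF d(4) _ S(2), of C] b(6) d(6) by blast
  ultimately have "B <#> ?R = D" using BS by blast
  \<comment> \<open>With \<open>B <#> ?R = D\<close> and \<open>B \<inter> ?R = C\<close>, the index
    |R : C| equals |D : B|.\<close>
  then have R: "idx ?R C = q ^ n" using idx_set_mult(4)[OF b(1) s(1)] BR q(2) by simp
  have "q ^ n \<noteq> 1" using idx_gt_1[OF d(4,5,3)] unfolding q(2) by linarith
  then have "?R \<noteq> C" using R idx_self[OF b(5)] by metis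
  then have "C \<subset> ?R" using s(2) by blast
  moreover have N: "subgroup (set_normalizer ?R) G" using set_normalizer_subgroup subgroup.subset[OF s(1)] by blast
  moreover have "C \<subseteq> set_normalizer ?R" using subset_set_normalizer[OF s(1)] s(2) by blast
  moreover have "carrier G = B <#> set_normalizer ?R"
    using frattini_product[OF b(2,1) d(1) q(1) S] BS by blast
  ultimately show thesis using that[OF s(1) _ R] normal_if_set_normalizer[OF s(1)] by blast
qed

text \<open>Take the largest normal \<open>C\<close> above \<open>N\<close> with \<open>p\<close>
  dividing |G : C|. A chief factor B/C is then a \<open>p\<close>-group, and |G : B| is prime to
  \<open>p\<close>. It suffices to find a proper supplement of B/C, and the Frattini argument on the
  next chief factor provides one.\<close>

lemma maximal_subgroup_prime_power_index:
  assumes sol: "solvable G" and N: "N \<lhd> G" and p: "prime p" "p dvd idx (carrier G) N"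
  obtains X k where "maximal_subgroup X G" "N \<subseteq> X" "idx (carrier G) X = p ^ k"
proof -
  note result = that
  let ?P = "\<lambda>C. C \<lhd> G \<and> N \<subseteq> C \<and> p dvd idx (carrier G) C"
  have "?P N" "\<forall>M. ?P M \<longrightarrow> card M < Suc (card (carrier G))"
    using N p card_subgroup_less[OF normal_imp_subgroup] by auto
  from ex_has_greatest_nat[of ?P, OF this]
  obtain C where C: "?P C" "\<And>C'. ?P C' \<Longrightarrow> card C' \<le> card C" by blast
  have Cs: "subgroup C G" using C normal_imp_subgroup by blast
  have notP: "\<not> p dvd idx (carrier G) C'" if "C' \<lhd> G" "C \<subset> C'" for C'
    using C that psubset_card_mono[OF finite_subgroup[OF normal_imp_subgroup[OF that(1)]] that(2)] by force
  have "C \<noteq> carrier G" using C(1) p(1) idx_self[OF subgroup_self] by auto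
  then have "C \<subset> carrier G" using subgroup.subset[OF Cs] by blast
  then obtain B where B: "chief_factor G B C"
    using chief_factor_exists[OF conjunct1[OF C(1)] normal_self] by metis
  note b = chief_factorD[OF B]
  have sub: "B \<subseteq> carrier G" using subgroup.subset[OF b(4)] .
  have pB: "\<not> p dvd idx (carrier G) B" using notP b(1,3) by blast
  have "idx (carrier G) C = idx (carrier G) B * idx B C"
    using idx_trans[OF subgroup_self b(4,5) sub b(6)] .
  then have "p dvd idx B C" using pB C(1) p(1) prime_dvd_mult_nat by auto
  moreover obtain r m where rm: "prime r" "m > 0" "idx B C = r ^ m"
    using chief_factor_prime_power[OF sol B] .
  ultimately have m: "idx B C = p ^ m" using p(1) prime_dvd_power primes_dvd_imp_eq by metis
  \<comment> \<open>A maximal subgroup \<open>X\<close> above a proper supplement has index |B : B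
    \<inter> X|, a divisor of the \<open>p\<close>-power |B : C|.\<close>
  have *: thesis if Y: "subgroup Y G" "Y \<noteq> carrier G" "C \<subseteq> Y" "carrier G = B <#> Y" for Y
  proof -
    obtain X where X: "maximal_subgroup X G" "Y \<subseteq> X" using maximal_subgroup_exists Y by blast
    have Xs: "subgroup X G" using X by (simp add: maximal_subgroup_def)
    have BX: "subgroup (B \<inter> X) G" "C \<subseteq> B \<inter> X" using subgroups_Inter_pair b(4,6) Xs X Y by auto
    have "carrier G \<subseteq> B <#> X" using Y(4) mono_set_mult[OF _ X(2), of B B] by blast
    moreover have "B <#> X \<subseteq> carrier G" using setmult_subset_G sub subgroup.subset[OF Xs] by blast
    ultimately have "idx (carrier G) X = idx B (B \<inter> X)" using idx_supplement[OF b(1) Xs] by blast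
    moreover have "idx B (B \<inter> X) dvd p ^ m"
      using idx_trans[OF b(4) BX(1) Cs _ BX(2)] m by auto
    ultimately obtain i where "idx (carrier G) X = p ^ i" using dvd_prime_powerE[OF p(1)] by metis
    then show thesis using result[OF X(1)] C(1) X(2) Y(3) by blast
  qed
  show thesis
  proof (cases "B = carrier G")
    case True
    \<comment> \<open>When \<open>B\<close> is the whole group, \<open>C\<close> itself is the
      proper supplement.\<close>
    have "B <#> C = B" using idx_set_mult(2)[OF b(1,5)] set_mult_subset[OF b(4) _ b(6), of B] by blast
    then show thesis using *[OF Cs] True b(3) by blast
  next
    case False
    then have "B \<subset> carrier G" using sub by blast
    then obtain D where D: "chief_factor G D B"
      using chief_factor_exists[OF b(1) normal_self] by metis
    note d = chief_factorD[OF D]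
    obtain q n where q: "prime q" "n > 0" "idx D B = q ^ n" using chief_factor_prime_power[OF sol D] .
    have "idx (carrier G) B = idx (carrier G) D * idx D B"
      using idx_trans[OF subgroup_self d(4,5) subgroup.subset[OF d(4)] d(6)] .
    then have qp: "q \<noteq> p" using pB q by auto
    obtain R where R: "subgroup R G" "C \<subset> R" "idx R C = q ^ n"
      "R \<lhd> G \<or> subgroup (set_normalizer R) G \<and> set_normalizer R \<noteq> carrier G \<and> C \<subseteq> set_normalizer R \<and> carrier G = B <#> set_normalizer R"
      using chief_factor_dichotomy[OF sol B D p(1) m q(1,3) qp] by metis
    \<comment> \<open>|R : C| is a power of \<open>q\<close>, so \<open>p\<close> still divides |G :
      R|; a normal \<open>R\<close> would contradict the choice of \<open>C\<close>.\<close>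
    have "\<not> R \<lhd> G"
    proof
      assume "R \<lhd> G"
      then have "\<not> p dvd idx (carrier G) R" using notP R(2) by blast
      moreover have "idx (carrier G) C = idx (carrier G) R * q ^ n"
        using idx_trans[OF subgroup_self R(1) Cs] R subgroup.subset[OF R(1)] by auto
      ultimately have "p dvd q ^ n" using C(1) p(1) prime_dvd_mult_nat by metis
      then show False using p(1) q(1) qp prime_dvd_power primes_dvd_imp_eq by metis
    qed
    then show thesis using * R(4) by blast
  qed
qed

subsection \<open>Normal Sylow subgroups of supersolvable groups\<close>

lemma conjugate_coset:
  assumes L: "L \<lhd> G" and t: "t \<in> carrier G" and h: "h \<in> carrier G"
  shows "(\<lambda>y. t \<otimes> y \<otimes> inv t) ` (L #> h) = L #> (t \<otimes> h \<otimes> inv t)"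
proof
  have Lc: "l \<in> carrier G" if "l \<in> L" for l
    using subgroup.mem_carrier[OF normal_imp_subgroup[OF L] that] .
  show "(\<lambda>y. t \<otimes> y \<otimes> inv t) ` (L #> h) \<subseteq> L #> (t \<otimes> h \<otimes> inv t)"
  proof
    fix z assume "z \<in> (\<lambda>y. t \<otimes> y \<otimes> inv t) ` (L #> h)"
    then obtain l where l: "l \<in> L" "z = t \<otimes> (l \<otimes> h) \<otimes> inv t" by (auto simp: r_coset_def)
    then have "z = (t \<otimes> l \<otimes> inv t) \<otimes> (t \<otimes> h \<otimes> inv t)" using t h Lc by (simp add: word_simps)
    then show "z \<in> L #> (t \<otimes> h \<otimes> inv t)"
      using normal_invE(2)[OF L t l(1)] by (auto simp: r_coset_def)
  qed
  show "L #> (t \<otimes> h \<otimes> inv t) \<subseteq> (\<lambda>y. t \<otimes> y \<otimes> inv t) ` (L #> h)"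
  proof
    fix z assume "z \<in> L #> (t \<otimes> h \<otimes> inv t)"
    then obtain l where l: "l \<in> L" "z = l \<otimes> (t \<otimes> h \<otimes> inv t)" by (auto simp: r_coset_def)
    then have "z = t \<otimes> ((inv t \<otimes> l \<otimes> inv (inv t)) \<otimes> h) \<otimes> inv t"
      using t h Lc by (simp add: word_simps)
    moreover have "(inv t \<otimes> l \<otimes> inv (inv t)) \<otimes> h \<in> L #> h"
      using normal_invE(2)[OF L inv_closed[OF t] l(1)] by (auto simp: r_coset_def)
    ultimately show "z \<in> (\<lambda>y. t \<otimes> y \<otimes> inv t) ` (L #> h)" by blast
  qed
qed

text \<open>\<open>A\<close> is any set invariant under \<open>Q\<close>, so that the action is
  available both on all cosets of \<open>L\<close> in \<open>H\<close> and on the nontrivial ones,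
  with \<open>A = H - L\<close>.\<close>

lemma conjugation_p_action:
  assumes L: "L \<lhd> G" and A: "A \<subseteq> carrier G"
    and cl: "\<And>t a. t \<in> Q \<Longrightarrow> a \<in> A \<Longrightarrow> t \<otimes> a \<otimes> inv t \<in> A"
    and Q: "subgroup Q G" "card Q = p ^ k" and p: "prime p"
  shows "p_action G Q p k ((\<lambda>h. L #> h) ` A) (\<lambda>t C. (\<lambda>y. t \<otimes> y \<otimes> inv t) ` C)"
proof unfold_locales
  have Qc: "t \<in> carrier G" if "t \<in> Q" for t using subgroup.mem_carrier[OF Q(1) that] .
  have Lc: "L \<subseteq> carrier G" using subgroup.subset[OF normal_imp_subgroup[OF L]] .
  show "finite ((\<lambda>h. L #> h) ` A)" using finite_subset[OF A finite_carrier] by blast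
  show "(\<lambda>y. g \<otimes> y \<otimes> inv g) ` C \<in> (\<lambda>h. L #> h) ` A"
    if "g \<in> Q" "C \<in> (\<lambda>h. L #> h) ` A" for g C
    using that cl[OF that(1)] conjugate_coset[OF L Qc[OF that(1)]] A by auto
  have Cc: "y \<in> carrier G" if "C \<in> (\<lambda>h. L #> h) ` A" "y \<in> C" for C y
    using that A Lc by (auto simp: r_coset_def subset_iff)
  show "(\<lambda>y. \<one> \<otimes> y \<otimes> inv \<one>) ` C = C" if "C \<in> (\<lambda>h. L #> h) ` A" for C
    using Cc[OF that] by (force simp: image_iff)
  show "(\<lambda>y. g \<otimes> h \<otimes> y \<otimes> inv (g \<otimes> h)) ` C
      = (\<lambda>y. g \<otimes> y \<otimes> inv g) ` (\<lambda>y. h \<otimes> y \<otimes> inv h) ` C"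
    if "g \<in> Q" "h \<in> Q" "C \<in> (\<lambda>h. L #> h) ` A" for g h C
    unfolding image_image using Cc[OF that(3)] Qc[OF that(1)] Qc[OF that(2)]
    by (intro image_cong refl) (simp add: word_simps)
qed (use Q p in \<open>auto simp: subgroup_def subset_iff\<close>)

lemma fixed_coset_commutator:
  assumes L: "L \<lhd> G" and t: "t \<in> carrier G" and h: "h \<in> carrier G"
    and fixed: "(\<lambda>y. t \<otimes> y \<otimes> inv t) ` (L #> h) = L #> h"
  shows "t \<otimes> h \<otimes> inv t \<otimes> inv h \<in> L"
proof -
  have Ls: "subgroup L G" using normal_imp_subgroup[OF L] .
  have "L #> (t \<otimes> h \<otimes> inv t) = L #> h" using fixed conjugate_coset[OF L t h] by simp
  then have "L #> (t \<otimes> h \<otimes> inv t \<otimes> inv h) = L"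
    using coset_mult_inv2[OF _ _ h subgroup.subset[OF Ls]] t h by simp
  then show ?thesis using coset_join1[OF _ _ Ls] t h by simp
qed

lemma card_cosets_mod:
  assumes L: "subgroup L G" and H: "subgroup H G" and LH: "L \<subseteq> H"
  shows "card ((\<lambda>h. L #> h) ` H) = idx H L" "card ((\<lambda>h. L #> h) ` (H - L)) = idx H L - 1"
proof -
  have "rcosets\<^bsub>G\<lparr>carrier := H\<rparr>\<^esub> L = (\<lambda>h. L #> h) ` H" by (auto simp: RCOSETS_def)
  then show 1: "card ((\<lambda>h. L #> h) ` H) = idx H L" using card_rcosets_subgroup[OF H L LH] by simp
  have "(\<lambda>h. L #> h) ` H = insert L ((\<lambda>h. L #> h) ` (H - L))"
  proof -
    have "(\<lambda>h. L #> h) ` L = {L}"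
      using subgroup.one_closed[OF L] coset_join2[OF _ L] subgroup.mem_carrier[OF L] by auto
    moreover have "(\<lambda>h. L #> h) ` H = (\<lambda>h. L #> h) ` L \<union> (\<lambda>h. L #> h) ` (H - L)"
      unfolding image_Un[symmetric] using Diff_partition[OF LH] by simp
    ultimately show ?thesis by simp
  qed
  moreover have "L \<notin> (\<lambda>h. L #> h) ` (H - L)"
    using coset_join1[OF _ _ L] subgroup.mem_carrier[OF H] by auto
  moreover have "finite ((\<lambda>h. L #> h) ` (H - L))" using finite_subgroup[OF H] by simp
  ultimately show "card ((\<lambda>h. L #> h) ` (H - L)) = idx H L - 1" using 1 by simp
qed

text \<open>\<open>Q\<close> acts by conjugation on fewer than \<open>p\<close> cosets, so every
  orbit is a single coset.\<close>

lemma p_group_centralizes_small_factor: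
  assumes L: "L \<lhd> G" and H: "H \<lhd> G" "L \<subseteq> H" and Q: "subgroup Q G" "card Q = p ^ k" and p: "prime p"
    and less: "idx H L < p" and t: "t \<in> Q" and h: "h \<in> H"
  shows "t \<otimes> h \<otimes> inv t \<otimes> inv h \<in> L"
proof -
  have Hs: "subgroup H G" using normal_imp_subgroup[OF H(1)] .
  interpret p_action G Q p k "(\<lambda>h. L #> h) ` H" "\<lambda>t C. (\<lambda>y. t \<otimes> y \<otimes> inv t) ` C"
    by (rule conjugation_p_action[OF L subgroup.subset[OF Hs] _ Q p])
       (use normal_invE(2)[OF H(1)] subgroup.mem_carrier[OF Q(1)] in auto)
  have "card ((\<lambda>h. L #> h) ` H) < p"
    using card_cosets_mod(1)[OF normal_imp_subgroup[OF L] Hs H(2)] less by simp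
  then have "(\<lambda>y. t \<otimes> y \<otimes> inv t) ` (L #> h) = L #> h"
    using trivial_if_card_less[OF _ imageI[OF h] t] by blast
  then show ?thesis
    by (rule fixed_coset_commutator[OF L subgroup.mem_carrier[OF Q(1) t] subgroup.mem_carrier[OF Hs h]])
qed

text \<open>There are |H : L| - 1 nontrivial cosets, a number prime to \<open>p\<close>, so
  \<open>Q\<close> fixes one of them.\<close>

lemma p_group_fixed_point_mod:
  assumes L: "L \<lhd> G" and H: "H \<lhd> G" "L \<subseteq> H" and Q: "subgroup Q G" "card Q = p ^ k" and p: "prime p"
    and dvd: "p dvd idx H L"
  obtains h where "h \<in> H" "h \<notin> L" "\<And>t. t \<in> Q \<Longrightarrow> t \<otimes> h \<otimes> inv t \<otimes> inv h \<in> L"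
proof -
  have Hs: "subgroup H G" and Ls: "subgroup L G" using normal_imp_subgroup H(1) L by auto
  have Qc: "t \<in> carrier G" if "t \<in> Q" for t using subgroup.mem_carrier[OF Q(1) that] .
  have Hc: "t \<in> carrier G" if "t \<in> H" for t using subgroup.mem_carrier[OF Hs that] .
  have cl: "t \<otimes> a \<otimes> inv t \<in> H - L" if t: "t \<in> Q" and a: "a \<in> H - L" for t a
  proof -
    have "t \<otimes> a \<otimes> inv t \<notin> L"
    proof
      assume "t \<otimes> a \<otimes> inv t \<in> L"
      then have "inv t \<otimes> (t \<otimes> a \<otimes> inv t) \<otimes> inv (inv t) \<in> L"
        using normal_invE(2)[OF L inv_closed[OF Qc[OF t]]] by blast
      then show False using Qc[OF t] Hc a by (simp add: word_simps)
    qed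
    then show ?thesis using normal_invE(2)[OF H(1) Qc[OF t]] a by blast
  qed
  have HLc: "H - L \<subseteq> carrier G" using Hc by blast
  interpret p_action G Q p k "(\<lambda>h. L #> h) ` (H - L)" "\<lambda>t C. (\<lambda>y. t \<otimes> y \<otimes> inv t) ` C"
    by (rule conjugation_p_action[OF L HLc cl Q p])
  have "\<not> p dvd idx H L - 1"
  proof
    assume "p dvd idx H L - 1"
    then have "p dvd idx H L - (idx H L - 1)" using dvd by (rule dvd_diff_nat[rotated])
    then have "p dvd 1" using idx_pos[OF Hs Ls H(2)] by simp
    then show False using p by simp
  qed
  then obtain C where C: "C \<in> (\<lambda>h. L #> h) ` (H - L)" "\<forall>t\<in>Q. (\<lambda>y. t \<otimes> y \<otimes> inv t) ` C = C"
    using fixed_point card_cosets_mod(2)[OF Ls Hs H(2)] by auto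
  then obtain h where h: "h \<in> H - L" "C = L #> h" by blast
  show thesis
    using that[of h] fixed_coset_commutator[OF L Qc Hc, of _ h] h C(2) by blast
qed

text \<open>Induction on |G| - |L|, passing to a chief factor H/L of prime order
  \<open>q \<le> r\<close> and to the normal Sylow \<open>r\<close>-subgroup S/H of G/H. If
  \<open>q = r\<close>, then \<open>S\<close> serves for \<open>L\<close> too. Otherwise a Sylow
  \<open>r\<close>-subgroup \<open>Q\<close> of \<open>S\<close> centralizes H/L, so
  \<open>H\<close> normalizes \<open>L <#> Q\<close>, and the Frattini argument makes this group
  normal in \<open>G\<close>.\<close>

lemma supersolvable_normal_sylow:
  assumes ss: "supersolvable G" and r: "prime r"
  shows "L \<lhd> G \<Longrightarrow> (\<And>q. prime q \<Longrightarrow> q dvd idx (carrier G) L \<Longrightarrow> q \<le> r) \<Longrightarrow>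
    \<exists>S k. S \<lhd> G \<and> L \<subseteq> S \<and> idx S L = r ^ k \<and> \<not> r dvd idx (carrier G) S"
proof (induction "card (carrier G) - card L" arbitrary: L rule: less_induct)
  case less
  have L: "L \<lhd> G" and Ls: "subgroup L G" using less.prems(1) normal_imp_subgroup by auto
  have Lc: "L \<subseteq> carrier G" using subgroup.subset[OF Ls] .
  show ?case
  proof (cases "L = carrier G")
    case True
    have "idx L L = r ^ 0" "\<not> r dvd idx (carrier G) L"
      using idx_self[OF Ls] r True not_prime_unit[of r] by auto
    then show ?thesis using L by blast
  next
    case False
    then have "L \<subset> carrier G" using Lc by blast
    then obtain H where ch: "chief_factor G H L" using chief_factor_exists[OF L normal_self] by metis
    note c = chief_factorD[OF ch]
    define q where "q = idx H L"
    have "prime (order (section_of G H L))" using ss ch unfolding supersolvable_def by blast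
    then have q: "prime q" using order_section[OF c(4,5,6)] by (simp add: q_def)
    have Hc: "H \<subseteq> carrier G" using subgroup.subset[OF c(4)] .
    have GL: "idx (carrier G) L = idx (carrier G) H * q"
      using idx_trans[OF subgroup_self c(4,5) Hc c(6)] by (simp add: q_def)
    then have qr: "q \<le> r" using less.prems(2)[OF q] by simp
    have "card (carrier G) - card H < card (carrier G) - card L"
      using psubset_card_mono[OF finite_subgroup[OF c(4)] c(3)] card_mono[OF finite_carrier Hc] by linarith
    then obtain S k where S: "S \<lhd> G" "H \<subseteq> S" "idx S H = r ^ k" "\<not> r dvd idx (carrier G) S"
      using less.hyps[OF _ c(1)] less.prems(2) GL by auto
    have Ss: "subgroup S G" using normal_imp_subgroup[OF S(1)] .
    have Sc: "S \<subseteq> carrier G" using subgroup.subset[OF Ss] .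
    have SL: "idx S L = r ^ k * q" using idx_trans[OF Ss c(4,5) S(2) c(6)] S(3) by (simp add: q_def)
    have LS: "L \<subseteq> S" using c(6) S(2) by blast
    show ?thesis
    proof (cases "q = r")
      case True
      then have "idx S L = r ^ Suc k" using SL by simp
      then show ?thesis using S LS by blast
    next
      case False
      obtain Q j where Q: "subgroup Q G" "Q \<subseteq> S" "card Q = r ^ j" "\<not> r dvd idx S Q"
        using sylow_exists[OF r Ss] .
      have Qc: "t \<in> carrier G" if "t \<in> Q" for t using subgroup.mem_carrier[OF Q(1) that] .
      have Hc': "t \<in> carrier G" if "t \<in> H" for t using subgroup.mem_carrier[OF c(4) that] .
      have Lc': "t \<in> carrier G" if "t \<in> L" for t using subgroup.mem_carrier[OF Ls that] .
      have HQ: "H <#> Q = S" using sylow_mult_eq[OF c(1) Ss S(2) r Q(1,2,4) S(3)] .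
      let ?R = "L <#> Q"
      note s = idx_set_mult[OF L Q(1)]
      have "H \<subseteq> set_normalizer ?R"
      proof
        fix h assume h: "h \<in> H"
        note hc = Hc'[OF h]
        show "h \<in> set_normalizer ?R"
        proof (rule set_normalizerI[OF s(1) hc])
          fix x assume "x \<in> ?R"
          then obtain l t where x: "l \<in> L" "t \<in> Q" "x = l \<otimes> t" by (auto simp: set_mult_def)
          \<comment> \<open>For \<open>x = l \<otimes> t\<close>, the conjugate of \<open>x\<close>
            by \<open>h\<close> is the conjugate of \<open>l\<close>, times the inverse of this
            commutator, times \<open>t\<close>; the first two factors lie in
            \<open>L\<close>.\<close>
          have "t \<otimes> h \<otimes> inv t \<otimes> inv h \<in> L"
            using p_group_centralizes_small_factor[OF L c(1,6) Q(1,3) r _ x(2) h] qr False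
            by (simp add: q_def)
          then have "(h \<otimes> l \<otimes> inv h) \<otimes> inv (t \<otimes> h \<otimes> inv t \<otimes> inv h) \<in> L"
            using normal_invE(2)[OF L hc x(1)] subgroup.m_closed[OF Ls] subgroup.m_inv_closed[OF Ls] by simp
          moreover have "h \<otimes> x \<otimes> inv h = (h \<otimes> l \<otimes> inv h) \<otimes> inv (t \<otimes> h \<otimes> inv t \<otimes> inv h) \<otimes> t"
            using hc Lc'[OF x(1)] Qc[OF x(2)] x(3) by (simp add: word_simps)
          ultimately show "h \<otimes> x \<otimes> inv h \<in> ?R" using x(2) by (auto simp: set_mult_def)
        qed
      qed
      moreover have "carrier G = H <#> set_normalizer ?R"
        using frattini_product[OF L c(1) S(1) r Q] HQ by blast
      ultimately have "set_normalizer ?R = carrier G"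
        using set_mult_supplement_mono[OF c(4) set_normalizer_subgroup] subgroup.subset[OF s(1)] by blast
      then have R: "?R \<lhd> G" using normal_if_set_normalizer[OF s(1)] by blast
      have "idx Q (L \<inter> Q) dvd r ^ j"
        using card_eq_idx[OF Q(1) subgroups_Inter_pair[OF Ls Q(1)]] Q(3) by (metis dvd_triv_left inf_le2)
      then obtain i where i: "idx ?R L = r ^ i" using s(4) dvd_prime_powerE[OF r] by metis
      have RS: "?R \<subseteq> S" using set_mult_subset[OF Ss LS Q(2)] .
      have eq: "r ^ k * q = idx S ?R * r ^ i" using idx_trans[OF Ss s(1) Ls RS s(2)] SL i by simp
      have "idx S Q = idx S ?R * idx ?R Q" using idx_trans[OF Ss s(1) Q(1) RS s(3)] .
      then have "\<not> r dvd idx S ?R" using Q(4) by auto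
      moreover have "idx (carrier G) ?R = idx (carrier G) S * idx S ?R"
        using idx_trans[OF subgroup_self Ss s(1) Sc RS] .
      ultimately have "\<not> r dvd idx (carrier G) ?R" using S(4) r prime_dvd_mult_nat by auto
      then show ?thesis using R s(2) i by blast
    qed
  qed
qed

section \<open>Normal subgroups with quotient of p-length at most one\<close>

text \<open>For \<open>N \<lhd> G\<close> and \<open>p\<close> prime this says that \<open>G/N\<close> has \<open>p\<close>-length at most 1. All of the argument is
  phrased with indices of subgroups of \<open>G\<close> itself, so that the hypothesis on maximal subgroups never
  has to be transported to a quotient.\<close>

definition p_length_le_1_mod :: "nat \<Rightarrow> 'a set \<Rightarrow> bool"
  where "p_length_le_1_mod p N \<longleftrightarrow>
    (\<exists>A B k. A \<lhd> G \<and> B \<lhd> G \<and> N \<subseteq> A \<and> A \<subseteq> B \<and>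
      \<not> p dvd idx A N \<and> idx B A = p ^ k \<and> \<not> p dvd idx (carrier G) B)"

text \<open>Going through \<open>N1 \<inter> A2\<close> splits the index into two factors, which
  divide |A1 : N1| and |A2 : N2|. This is the index form of an embedding into a direct
  product.\<close>

lemma idx_Int_dvd:
  assumes N: "N1 \<lhd> G" "N2 \<lhd> G" and A: "subgroup A1 G" "subgroup A2 G" "N1 \<subseteq> A1" "N2 \<subseteq> A2"
  shows "idx (A1 \<inter> A2) (N1 \<inter> N2) dvd idx A1 N1 * idx A2 N2"
proof -
  note Ns = N[THEN normal_imp_subgroup]
  have eq: "N1 \<inter> (A1 \<inter> A2) = N1 \<inter> A2" "N2 \<inter> (N1 \<inter> A2) = N1 \<inter> N2" using A(3,4) by auto
  have "idx (A1 \<inter> A2) (N1 \<inter> N2) = idx (A1 \<inter> A2) (N1 \<inter> A2) * idx (N1 \<inter> A2) (N1 \<inter> N2)"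
    by (rule idx_trans) (use subgroups_Inter_pair Ns A in auto)
  moreover have "idx (A1 \<inter> A2) (N1 \<inter> A2) dvd idx A1 N1"
    using idx_dvd_of_inter[OF N(1) subgroups_Inter_pair[OF A(1,2)] A(1,3)] unfolding eq by blast
  moreover have "idx (N1 \<inter> A2) (N1 \<inter> N2) dvd idx A2 N2"
    using idx_dvd_of_inter[OF N(2) subgroups_Inter_pair[OF Ns(1) A(2)] A(2,4)] unfolding eq by blast
  ultimately show ?thesis using mult_dvd_mono by metis
qed

text \<open>Intersecting the two series term by term gives one for
  \<open>N1 \<inter> N2\<close>.\<close>

lemma p_length_le_1_mod_Int:
  assumes p: "prime p" and N: "N1 \<lhd> G" "N2 \<lhd> G"
    and 1: "p_length_le_1_mod p N1" and 2: "p_length_le_1_mod p N2"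
  shows "p_length_le_1_mod p (N1 \<inter> N2)"
proof -
  obtain A1 B1 k1 where a: "A1 \<lhd> G" "B1 \<lhd> G" "N1 \<subseteq> A1" "A1 \<subseteq> B1"
      "\<not> p dvd idx A1 N1" "idx B1 A1 = p ^ k1" "\<not> p dvd idx (carrier G) B1"
    using 1 by (auto simp: p_length_le_1_mod_def)
  obtain A2 B2 k2 where b: "A2 \<lhd> G" "B2 \<lhd> G" "N2 \<subseteq> A2" "A2 \<subseteq> B2"
      "\<not> p dvd idx A2 N2" "idx B2 A2 = p ^ k2" "\<not> p dvd idx (carrier G) B2"
    using 2 by (auto simp: p_length_le_1_mod_def)
  note as = a(1,2)[THEN normal_imp_subgroup] and bs = b(1,2)[THEN normal_imp_subgroup]
  have "\<not> p dvd idx (A1 \<inter> A2) (N1 \<inter> N2)"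
    using idx_Int_dvd[OF N as(1) bs(1) a(3) b(3)] a(5) b(5) prime_dvd_mult_nat[OF p]
    by (meson dvd_trans)
  moreover have "idx (B1 \<inter> B2) (A1 \<inter> A2) dvd p ^ (k1 + k2)"
    using idx_Int_dvd[OF a(1) b(1) as(2) bs(2) a(4) b(4)] a(6) b(6) by (simp add: power_add)
  then obtain k where "idx (B1 \<inter> B2) (A1 \<inter> A2) = p ^ k" using dvd_prime_powerE[OF p] by metis
  moreover have "\<not> p dvd idx (carrier G) (B1 \<inter> B2)"
    using idx_Int_dvd[OF a(2) b(2) subgroup_self subgroup_self] subgroup.subset[OF as(2)]
      subgroup.subset[OF bs(2)] a(7) b(7) prime_dvd_mult_nat[OF p]
    by (metis dvd_trans inf.idem)
  moreover have "A1 \<inter> A2 \<lhd> G" "B1 \<inter> B2 \<lhd> G" using normal_subgroup_intersect a b by auto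
  moreover have "N1 \<inter> N2 \<subseteq> A1 \<inter> A2" "A1 \<inter> A2 \<subseteq> B1 \<inter> B2" using a b by auto
  ultimately show ?thesis unfolding p_length_le_1_mod_def by blast
qed

lemma supersolvable_subgroup_normal_sylow:
  assumes Y: "subgroup Y G" "supersolvable (G\<lparr>carrier := Y\<rparr>)" and N: "N \<lhd> G" "N \<subseteq> Y"
    and r: "prime r" "\<And>q. prime q \<Longrightarrow> q dvd idx Y N \<Longrightarrow> q \<le> r"
  obtains S k where "subgroup S G" "N \<subseteq> S" "S \<subseteq> Y" "\<And>y s. y \<in> Y \<Longrightarrow> s \<in> S \<Longrightarrow> y \<otimes> s \<otimes> inv y \<in> S"
    "idx S N = r ^ k" "\<not> r dvd idx Y S"
proof -
  interpret Y: finite_group "G\<lparr>carrier := Y\<rparr>"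
    using subgroup_finite_group[OF finite_carrier Y(1)] .
  have NY: "N \<lhd> G\<lparr>carrier := Y\<rparr>"
    unfolding normal_nested_iff[OF Y(1)]
    using N normal_imp_subgroup[OF N(1)] normal_invE(2)[OF N(1) subgroup.mem_carrier[OF Y(1)]] by blast
  then obtain S k where S: "S \<lhd> G\<lparr>carrier := Y\<rparr>" "N \<subseteq> S" "idx S N = r ^ k" "\<not> r dvd idx Y S"
    using Y.supersolvable_normal_sylow[OF Y(2) r(1) NY] r(2) by auto
  then show thesis using that unfolding normal_nested_iff[OF Y(1)] by blast
qed

text \<open>For normal \<open>K\<close> this is the preimage in \<open>G\<close> of the centralizer,
  in G/K, of the image of the set \<open>H\<close>.\<close>

definition centralizer_mod :: "'a set \<Rightarrow> 'a set \<Rightarrow> 'a set"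
  where "centralizer_mod K H = {g \<in> carrier G. \<forall>h\<in>H. g \<otimes> h \<otimes> inv g \<otimes> inv h \<in> K}"

lemma commutator_sym:
  assumes K: "subgroup K G" and c: "a \<in> carrier G" "b \<in> carrier G"
    and "a \<otimes> b \<otimes> inv a \<otimes> inv b \<in> K"
  shows "b \<otimes> a \<otimes> inv b \<otimes> inv a \<in> K"
proof -
  have "inv (a \<otimes> b \<otimes> inv a \<otimes> inv b) \<in> K" using subgroup.m_inv_closed[OF K assms(4)] .
  then show ?thesis using c by (simp add: word_simps)
qed

lemma centralizer_mod_subgroup:
  assumes K: "K \<lhd> G" and H: "H \<subseteq> carrier G"
  shows "subgroup (centralizer_mod K H) G"
proof (rule subgroupI)
  interpret K: normal K G by (fact K)
  have Hc: "h \<in> carrier G" if "h \<in> H" for h using that H by blast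
  show "centralizer_mod K H \<subseteq> carrier G" by (auto simp: centralizer_mod_def)
  have "\<one> \<in> centralizer_mod K H" using Hc by (auto simp: centralizer_mod_def K.one_closed)
  then show "centralizer_mod K H \<noteq> {}" by blast
next
  interpret K: normal K G by (fact K)
  have Hc: "h \<in> carrier G" if "h \<in> H" for h using that H by blast
  fix a assume a: "a \<in> centralizer_mod K H"
  then have ac: "a \<in> carrier G" by (simp add: centralizer_mod_def)
  have "inv a \<otimes> h \<otimes> inv (inv a) \<otimes> inv h \<in> K" if h: "h \<in> H" for h
  proof -
    have "inv a \<otimes> inv (a \<otimes> h \<otimes> inv a \<otimes> inv h) \<otimes> a \<in> K"
      using a h ac K.inv_op_closed1 K.m_inv_closed by (simp add: centralizer_mod_def)
    then show ?thesis using ac Hc[OF h] by (simp add: word_simps)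
  qed
  then show "inv a \<in> centralizer_mod K H" using ac by (simp add: centralizer_mod_def)
next
  interpret K: normal K G by (fact K)
  have Hc: "h \<in> carrier G" if "h \<in> H" for h using that H by blast
  fix a b assume ab: "a \<in> centralizer_mod K H" "b \<in> centralizer_mod K H"
  then have c: "a \<in> carrier G" "b \<in> carrier G" by (auto simp: centralizer_mod_def)
  have "(a \<otimes> b) \<otimes> h \<otimes> inv (a \<otimes> b) \<otimes> inv h \<in> K" if h: "h \<in> H" for h
  proof -
    have "b \<otimes> h \<otimes> inv b \<otimes> inv h \<in> K" "a \<otimes> h \<otimes> inv a \<otimes> inv h \<in> K"
      using ab h by (auto simp: centralizer_mod_def)
    then have "(a \<otimes> (b \<otimes> h \<otimes> inv b \<otimes> inv h) \<otimes> inv a) \<otimes> (a \<otimes> h \<otimes> inv a \<otimes> inv h) \<in> K"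
      using K.m_closed[OF K.inv_op_closed2[OF c(1)]] by blast
    then show ?thesis using c Hc[OF h] by (simp add: word_simps)
  qed
  then show "a \<otimes> b \<in> centralizer_mod K H" using c by (simp add: centralizer_mod_def)
qed

lemma centralizer_mod_conj:
  assumes K: "K \<lhd> G" and H: "H \<subseteq> carrier G" and y: "y \<in> carrier G" "\<And>h. h \<in> H \<Longrightarrow> inv y \<otimes> h \<otimes> y \<in> H"
    and g: "g \<in> centralizer_mod K H"
  shows "y \<otimes> g \<otimes> inv y \<in> centralizer_mod K H"
proof -
  have gc: "g \<in> carrier G" using g by (simp add: centralizer_mod_def)
  have "(y \<otimes> g \<otimes> inv y) \<otimes> h \<otimes> inv (y \<otimes> g \<otimes> inv y) \<otimes> inv h \<in> K" if h: "h \<in> H" for h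
  proof -
    have hc: "h \<in> carrier G" using h H by blast
    have "g \<otimes> (inv y \<otimes> h \<otimes> y) \<otimes> inv g \<otimes> inv (inv y \<otimes> h \<otimes> y) \<in> K"
      using g y(2)[OF h] by (simp add: centralizer_mod_def)
    from normal_invE(2)[OF K y(1) this] show ?thesis
      using hc gc y(1) by (simp add: word_simps)
  qed
  then show ?thesis using y gc by (simp add: centralizer_mod_def)
qed

lemma subset_centralizer_mod:
  assumes K: "K \<lhd> G" and H: "H \<subseteq> carrier G"
  shows "K \<subseteq> centralizer_mod K H"
proof
  interpret K: normal K G by (fact K)
  fix k assume k: "k \<in> K"
  have "k \<otimes> h \<otimes> inv k \<otimes> inv h \<in> K" if h: "h \<in> H" for h
  proof -
    have hc: "h \<in> carrier G" using h H by blast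
    have "k \<otimes> (h \<otimes> inv k \<otimes> inv h) \<in> K"
      using K.m_closed[OF k K.inv_op_closed2[OF hc K.m_inv_closed[OF k]]] .
    then show ?thesis using hc K.mem_carrier[OF k] by (simp add: m_assoc)
  qed
  then show "k \<in> centralizer_mod K H" using K.mem_carrier[OF k] by (simp add: centralizer_mod_def)
qed

subsection \<open>Groups of \<open>p\<close>-length one\<close>

text \<open>The assumption \<open>above\<close> turns a failure at \<open>N0\<close> into a maximal
  counterexample, from which the contradiction is derived.\<close>

lemma p_length_le_1_mod_step:
  assumes p: "prime p" and sol: "solvable G"
    and hyp: "\<And>M. maximal_subgroup M G \<Longrightarrow>
           prime_divisors_order (G\<lparr>carrier := M\<rparr>) = prime_divisors_order G \<Longrightarrow>
           supersolvable (G\<lparr>carrier := M\<rparr>)"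
    and N0: "N0 \<lhd> G" and above: "\<And>K. K \<lhd> G \<Longrightarrow> N0 \<subset> K \<Longrightarrow> p_length_le_1_mod p K"
  shows "p_length_le_1_mod p N0"
proof (rule ccontr)
  assume neg: "\<not> p_length_le_1_mod p N0"
  have negI: False if "A \<lhd> G" "B \<lhd> G" "N0 \<subseteq> A" "A \<subseteq> B"
      "\<not> p dvd idx A N0" "idx B A = p ^ k" "\<not> p dvd idx (carrier G) B" for A B k
    using neg that unfolding p_length_le_1_mod_def by blast
  have N0s: "subgroup N0 G" using normal_imp_subgroup[OF N0] .
  have p1: "\<not> p dvd 1" using not_prime_unit p by blast
  \<comment> \<open>G/N0 has no nontrivial normal p'-subgroup: if |K : N0| were prime to
    \<open>p\<close>, the series for \<open>K\<close> would also be one for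
    \<open>N0\<close>.\<close>
  have dvd_above: "p dvd idx K N0" if K: "K \<lhd> G" "N0 \<subset> K" for K
  proof (rule ccontr)
    assume nd: "\<not> p dvd idx K N0"
    obtain A B k where a: "A \<lhd> G" "B \<lhd> G" "K \<subseteq> A" "A \<subseteq> B"
      "\<not> p dvd idx A K" "idx B A = p ^ k" "\<not> p dvd idx (carrier G) B"
      using above[OF K] by (auto simp: p_length_le_1_mod_def)
    have "idx A N0 = idx A K * idx K N0"
      using idx_trans[OF normal_imp_subgroup[OF a(1)] normal_imp_subgroup[OF K(1)] N0s a(3)] K(2) by blast
    then have "\<not> p dvd idx A N0" using nd a(5) p prime_dvd_mult_nat by auto
    then show False using negI[OF a(1,2) _ a(4) _ a(6,7)] a(3) K(2) by blast
  qed
  have "N0 \<noteq> carrier G"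
    using negI[OF normal_self normal_self, of 0] idx_self[OF subgroup_self] p1 by auto
  then have "N0 \<subset> carrier G" using subgroup.subset[OF N0s] by blast
  then obtain N where ch: "chief_factor G N N0" using chief_factor_exists[OF N0 normal_self] by metis
  note c = chief_factorD[OF ch]
  have Nc: "N \<subseteq> carrier G" using subgroup.subset[OF c(4)] .
  obtain r0 n where n0: "prime r0" "n > 0" "idx N N0 = r0 ^ n" using chief_factor_prime_power[OF sol ch] .
  then have n: "idx N N0 = p ^ n"
    using dvd_above[OF c(1,3)] p prime_dvd_power primes_dvd_imp_eq by metis
  obtain A B k where a: "A \<lhd> G" "B \<lhd> G" "N \<subseteq> A" "A \<subseteq> B"
      "\<not> p dvd idx A N" "idx B A = p ^ k" "\<not> p dvd idx (carrier G) B"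
    using above[OF c(1,3)] by (auto simp: p_length_le_1_mod_def)
  \<comment> \<open>If \<open>A = N\<close>, the \<open>p\<close>-factors B/N and N/N0 merge into a
    single one above \<open>N0\<close>.\<close>
  have "A \<noteq> N"
  proof
    assume "A = N"
    moreover have "idx B N0 = idx B N * idx N N0"
      using idx_trans[OF normal_imp_subgroup[OF a(2)] c(4,5) _ c(6)] a(3,4) by blast
    ultimately have "idx B N0 = p ^ (k + n)" using a(6) n by (simp add: power_add)
    then show False using negI[OF N0 a(2) _ _ _ _ a(7)] a(3,4) c(6) p1 idx_self[OF N0s] by auto
  qed
  then have "N \<subset> A" using a(3) by blast
  then obtain L where chL: "chief_factor G L N" "L \<subseteq> A" using chief_factor_exists[OF c(1) a(1)] by metis
  note l = chief_factorD[OF chL(1)]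
  obtain q m where q: "prime q" "m > 0" "idx L N = q ^ m" using chief_factor_prime_power[OF sol chL(1)] .
  have "idx A N = idx A L * idx L N"
    using idx_trans[OF normal_imp_subgroup[OF a(1)] l(4,5) chL(2) l(6)] .
  then have qp: "q \<noteq> p" using a(5) q by auto
  obtain R where R: "subgroup R G" "N0 \<subset> R" "idx R N0 = q ^ m"
      "R \<lhd> G \<or> subgroup (set_normalizer R) G \<and> set_normalizer R \<noteq> carrier G \<and> N0 \<subseteq> set_normalizer R \<and> carrier G = N <#> set_normalizer R"
    using chief_factor_dichotomy[OF sol ch chL(1) p n q(1,3) qp] by metis
  \<comment> \<open>|R : N0| is prime to \<open>p\<close>, so \<open>R\<close> is not normal and its
    normalizer is a proper supplement of N/N0, hence a complement.\<close>
  define M where "M = set_normalizer R"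
  have "\<not> R \<lhd> G"
    using dvd_above[OF _ R(2)] R(3) p q(1) qp prime_dvd_power primes_dvd_imp_eq by metis
  then have M: "subgroup M G" "M \<noteq> carrier G" "N0 \<subseteq> M" "carrier G = N <#> M"
    using R(4) by (auto simp: M_def)
  have NM: "N \<inter> M = N0" using chief_factor_supplement[OF sol ch M(1,3,2,4)] .
  have idxM: "idx (carrier G) M = p ^ n" using idx_supplement[OF c(1) M(1,4)] NM n by simp
  have "maximal_subgroup M G"
    unfolding maximal_subgroup_def
  proof (intro conjI allI impI M)
    \<comment> \<open>A proper subgroup above \<open>M\<close> is again a complement of N/N0 and
      therefore has the same index as \<open>M\<close>.\<close>
    fix Y assume Y: "subgroup Y G" "M \<subseteq> Y"
    show "Y = M \<or> Y = carrier G"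
    proof (rule disjCI)
      assume Yne: "Y \<noteq> carrier G"
      have Yc: "Y \<subseteq> carrier G" using subgroup.subset[OF Y(1)] .
      have "carrier G \<subseteq> N <#> Y" using M(4) mono_set_mult[of N N M Y G] Y(2) by simp
      then have GNY: "carrier G = N <#> Y" using setmult_subset_G[OF Nc Yc] by blast
      have "N \<inter> Y = N0" using chief_factor_supplement[OF sol ch Y(1) _ Yne GNY] M(3) Y(2) by blast
      then have "idx (carrier G) Y = idx (carrier G) M"
        using idx_supplement[OF c(1) Y(1) GNY] n idxM by simp
      moreover have "idx (carrier G) M = idx (carrier G) Y * idx Y M"
        using idx_trans[OF subgroup_self Y(1) M(1) Yc Y(2)] .
      ultimately have "idx Y M = 1" using idx_pos[OF subgroup_self Y(1) Yc] by simp
      then show "Y = M" using idx_eq_1[OF Y(1) M(1) Y(2)] by blast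
    qed
  qed
  \<comment> \<open>A subgroup of \<open>p\<close>-power index has the prime divisors of
    \<open>G\<close>, provided that its order is divisible by \<open>p\<close>.\<close>
  have ss: "supersolvable (G\<lparr>carrier := Y\<rparr>)"
    if Y: "maximal_subgroup Y G" "idx (carrier G) Y = p ^ i" "p dvd card Y" for Y i
  proof (rule hyp[OF Y(1)])
    have Ys: "subgroup Y G" using Y(1) by (simp add: maximal_subgroup_def)
    have "order G = p ^ i * card Y"
      using card_eq_idx[OF subgroup_self Ys subgroup.subset[OF Ys]] Y(2) by (simp add: order_def)
    then have "s dvd order G \<longleftrightarrow> s dvd card Y" if s: "prime s" for s
      using Y(3) s p by (metis dvd_mult prime_dvd_mult_nat prime_dvd_power primes_dvd_imp_eq)
    then show "prime_divisors_order (G\<lparr>carrier := Y\<rparr>) = prime_divisors_order G"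
      unfolding prime_divisors_order_def by (auto simp: order_def)
  qed
  have pN: "p dvd idx N N0" using n n0(2) by simp
  \<comment> \<open>Otherwise the terms \<open>N0\<close> and \<open>N\<close> would already witness
    p-length at most one above \<open>N0\<close>.\<close>
  have pGN: "p dvd idx (carrier G) N"
    using negI[OF N0 c(1) subset_refl c(6) _ n] idx_self[OF N0s] p1 by auto
  have "idx (carrier G) N = idx M N0" using idx_set_mult(4)[OF c(1) M(1)] M(4) NM by simp
  then have pM: "p dvd idx M N0" using pGN by simp
  have Mss: "supersolvable (G\<lparr>carrier := M\<rparr>)"
    using ss[OF \<open>maximal_subgroup M G\<close> idxM] card_eq_idx[OF M(1) N0s M(3)] pM by simp
  obtain X i where X: "maximal_subgroup X G" "N \<subseteq> X" "idx (carrier G) X = p ^ i"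
    using maximal_subgroup_prime_power_index[OF sol c(1) p pGN] .
  have Xs: "subgroup X G" using X(1) by (simp add: maximal_subgroup_def)
  have Xc: "X \<subseteq> carrier G" using subgroup.subset[OF Xs] .
  have N0X: "N0 \<subseteq> X" using c(6) X(2) by blast
  have pX: "p dvd idx X N0" using idx_trans[OF Xs c(4,5) X(2) c(6)] pN by simp
  have Xss: "supersolvable (G\<lparr>carrier := X\<rparr>)"
    using ss[OF X(1,3)] card_eq_idx[OF Xs N0s N0X] pX by simp
  define C where "C = centralizer_mod N0 N"
  define D where "D = C \<inter> M"
  have Cs: "subgroup C G" unfolding C_def by (rule centralizer_mod_subgroup[OF N0 Nc])
  have Ds: "subgroup D G" unfolding D_def by (rule subgroups_Inter_pair[OF Cs M(1)])
  have N0C: "N0 \<subseteq> C" unfolding C_def by (rule subset_centralizer_mod[OF N0 Nc])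
  have N0D: "N0 \<subseteq> D" using N0C M(3) by (auto simp: D_def)
  have NmemC: "x \<in> carrier G" if "x \<in> N" for x using Nc that by blast
  have MmemC: "x \<in> carrier G" if "x \<in> M" for x using subgroup.mem_carrier[OF M(1) that] .
  have Cconj: "y \<otimes> g \<otimes> inv y \<in> C" if y: "y \<in> carrier G" and g: "g \<in> C" for y g
    unfolding C_def
    by (rule centralizer_mod_conj[OF N0 Nc y _ g[unfolded C_def]])
       (use normal_invE(2)[OF c(1) inv_closed[OF y]] y in simp)
  \<comment> \<open>\<open>N\<close> centralizes \<open>D\<close> modulo \<open>N0\<close>, while
    \<open>M\<close> normalizes both \<open>C\<close> and itself; together they generate
    \<open>G\<close>.\<close>
  have "D \<lhd> G"
  proof (rule normal_if_supplement[OF c(4) M(1,4) Ds])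
    show "N \<subseteq> set_normalizer D"
    proof
      fix x assume x: "x \<in> N"
      have "x \<otimes> d \<otimes> inv x \<otimes> inv d \<in> N0" if d: "d \<in> D" for d
      proof (rule commutator_sym[OF N0s _ NmemC[OF x]])
        show "d \<in> carrier G" using subgroup.mem_carrier[OF Ds d] .
        show "d \<otimes> x \<otimes> inv d \<otimes> inv x \<in> N0"
          using d x by (auto simp: D_def C_def centralizer_mod_def)
      qed
      then show "x \<in> set_normalizer D" using normalizes_between[OF N0s Ds N0D NmemC[OF x]] by blast
    qed
    show "M \<subseteq> set_normalizer D"
    proof
      fix x assume x: "x \<in> M"
      show "x \<in> set_normalizer D"
        by (rule set_normalizerI[OF Ds MmemC[OF x]])
           (use Cconj[OF MmemC[OF x]] subgroup.m_closed[OF M(1)] subgroup.m_inv_closed[OF M(1) x] x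
            in \<open>auto simp: D_def\<close>)
    qed
  qed
  \<comment> \<open>\<open>D\<close> meets \<open>N\<close> in \<open>N0\<close>. If
    \<open>D\<close> were larger, the property would hold for \<open>D\<close> and for
    \<open>N\<close>, and so for their intersection.\<close>
  have DN0: "D = N0"
  proof (rule ccontr)
    assume "D \<noteq> N0"
    then have "p_length_le_1_mod p D" using above[OF \<open>D \<lhd> G\<close>] N0D by blast
    then have "p_length_le_1_mod p (D \<inter> N)"
      using p_length_le_1_mod_Int[OF p \<open>D \<lhd> G\<close> c(1) _ above[OF c(1,3)]] by blast
    moreover have "D \<inter> N = N0" using NM N0D c(6) by (auto simp: D_def)
    ultimately show False using neg by simp
  qed
  \<comment> \<open>N/N0 is abelian, so \<open>N \<subseteq> C\<close>; in a factorization of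
    \<open>g\<close> along \<open>N <#> M\<close> the second factor then lies in
    \<open>C \<inter> M = N0\<close>.\<close>
  have CN: "C \<subseteq> N"
  proof
    fix g assume g: "g \<in> C"
    then have "g \<in> N <#> M" using subgroup.mem_carrier[OF Cs g] M(4) by simp
    then obtain x y where xy: "x \<in> N" "y \<in> M" "g = x \<otimes> y" by (auto simp: set_mult_def)
    have "x \<in> C"
      using chief_factor_commutator[OF sol ch xy(1)] NmemC[OF xy(1)] by (simp add: C_def centralizer_mod_def)
    then have "inv x \<otimes> g \<in> C" using subgroup.m_closed[OF Cs subgroup.m_inv_closed[OF Cs] g] by blast
    then have "y \<in> C" using xy NmemC MmemC by (simp add: word_simps)
    then have "y \<in> N" using xy(2) DN0 c(6) by (auto simp: D_def)
    then show "g \<in> N" using xy subgroup.m_closed[OF c(4)] by simp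
  qed
  let ?pr = "{s. prime s \<and> s dvd idx (carrier G) N0}"
  have GN0: "idx (carrier G) N0 = p ^ i * idx X N0"
    using idx_trans[OF subgroup_self Xs N0s Xc N0X] X(3) by simp
  have idx0: "idx (carrier G) N0 > 0" using idx_pos[OF subgroup_self N0s] Xc N0X by blast
  then have fin: "finite ?pr" by (auto intro: finite_subset[OF _ finite_atMost] dest: dvd_imp_le)
  have "p \<in> ?pr" using GN0 pX p by simp
  define r where "r = Max ?pr"
  have r: "prime r" "r dvd idx (carrier G) N0" using Max_in[OF fin] \<open>p \<in> ?pr\<close> by (auto simp: r_def)
  have rmax: "s \<le> r" if "prime s" "s dvd idx (carrier G) N0" for s
    using Max_ge[OF fin] that by (simp add: r_def)
  show False
  proof (cases "r = p")
    case False
    have "s \<le> r" if "prime s" "s dvd idx X N0" for s using rmax[OF that(1)] that(2) GN0 by simp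
    then obtain S j where S: "subgroup S G" "N0 \<subseteq> S" "S \<subseteq> X"
      "\<And>y s. y \<in> X \<Longrightarrow> s \<in> S \<Longrightarrow> y \<otimes> s \<otimes> inv y \<in> S" "idx S N0 = r ^ j" "\<not> r dvd idx X S"
      using supersolvable_subgroup_normal_sylow[OF Xs Xss N0 N0X r(1)] by metis
    have Sc: "s \<in> carrier G" if "s \<in> S" for s using subgroup.mem_carrier[OF S(1) that] .
    have "\<not> r dvd p ^ i" using False r(1) p prime_dvd_power primes_dvd_imp_eq by metis
    then have "r dvd idx X N0" using r GN0 prime_dvd_mult_nat by auto
    then have SN0: "S \<noteq> N0" using S(6) by blast
    have "coprime (idx S N0) (idx N N0)"
      unfolding S(5) n using primes_coprime[OF r(1) p False] by simp
    then have SN: "S \<inter> N = N0" using Int_eq_if_coprime_idx[OF S(1) c(4,5) S(2) c(6)] by blast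
    \<comment> \<open>\<open>S\<close> is normalized by \<open>X\<close>, which contains
      \<open>N\<close>, and \<open>N\<close> is normal, so commutators of \<open>S\<close> with
      \<open>N\<close> lie in \<open>S \<inter> N = N0\<close>.\<close>
    have "S \<subseteq> C"
    proof
      fix s assume s: "s \<in> S"
      have "s \<otimes> x \<otimes> inv s \<otimes> inv x \<in> N0" if x: "x \<in> N" for x
      proof -
        have "(s \<otimes> x \<otimes> inv s) \<otimes> inv x \<in> N"
          using normal_invE(2)[OF c(1) Sc[OF s] x] subgroup.m_closed[OF c(4)]
            subgroup.m_inv_closed[OF c(4) x] by blast
        moreover have "s \<otimes> (x \<otimes> inv s \<otimes> inv x) \<in> S"
          using S(4)[of x "inv s"] X(2) x subgroup.m_inv_closed[OF S(1) s] subgroup.m_closed[OF S(1) s] by blast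
        then have "s \<otimes> x \<otimes> inv s \<otimes> inv x \<in> S" using Sc[OF s] NmemC[OF x] by (simp add: m_assoc)
        ultimately show ?thesis using SN by blast
      qed
      then show "s \<in> C" using Sc[OF s] by (simp add: C_def centralizer_mod_def)
    qed
    then show False using CN SN SN0 S(2) by blast
  next
    case True
    have Mc: "M \<subseteq> carrier G" using subgroup.subset[OF M(1)] .
    have "idx (carrier G) N0 = idx (carrier G) M * idx M N0"
      using idx_trans[OF subgroup_self M(1) N0s Mc M(3)] .
    then have "s \<le> p" if "prime s" "s dvd idx M N0" for s using rmax[OF that(1)] that(2) True by simp
    then obtain T j where T: "subgroup T G" "N0 \<subseteq> T" "T \<subseteq> M"
      "\<And>y s. y \<in> M \<Longrightarrow> s \<in> T \<Longrightarrow> y \<otimes> s \<otimes> inv y \<in> T" "idx T N0 = p ^ j" "\<not> p dvd idx M T"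
      using supersolvable_subgroup_normal_sylow[OF M(1) Mss N0 M(3) p] by metis
    have Tc: "T \<subseteq> carrier G" using subgroup.subset[OF T(1)] .
    \<comment> \<open>\<open>T\<close> is a \<open>p\<close>-group only modulo \<open>N0\<close>,
      whereas the fixed point argument acts with an actual \<open>p\<close>-subgroup; hence the
      detour through \<open>P\<close> with \<open>N0 <#> P = T\<close>.\<close>
    obtain P e where P: "subgroup P G" "P \<subseteq> T" "card P = p ^ e" "\<not> p dvd idx T P"
      using sylow_exists[OF p T(1)] .
    have TP: "N0 <#> P = T" using sylow_mult_eq[OF N0 T(1,2) p P(1,2,4) T(5)] .
    obtain h where h: "h \<in> N" "h \<notin> N0" "\<And>t. t \<in> P \<Longrightarrow> t \<otimes> h \<otimes> inv t \<otimes> inv h \<in> N0"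
      using p_group_fixed_point_mod[OF N0 c(1,6) P(1,3) p pN] by metis
    have hc: "{h} \<subseteq> carrier G" using NmemC[OF h(1)] by simp
    have "P \<subseteq> centralizer_mod N0 {h}"
      using h(3) subgroup.mem_carrier[OF P(1)] by (auto simp: centralizer_mod_def)
    then have "N0 <#> P \<subseteq> centralizer_mod N0 {h}"
      by (rule set_mult_subset[OF centralizer_mod_subgroup[OF N0 hc] subset_centralizer_mod[OF N0 hc]])
    then have Th: "t \<otimes> h \<otimes> inv t \<otimes> inv h \<in> N0" if "t \<in> T" for t
      using TP that by (auto simp: centralizer_mod_def)
    \<comment> \<open>\<open>E\<close> consists of the points of \<open>N\<close> fixed by
      \<open>T\<close> modulo \<open>N0\<close>. It contains \<open>h\<close> and is normalized by
      \<open>N\<close> and by \<open>M\<close>, so the chief property makes it all of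
      \<open>N\<close>. Thus \<open>T \<subseteq> C \<inter> M = N0\<close>, although
      \<open>p\<close> divides |M : N0|.\<close>
    define E where "E = N \<inter> centralizer_mod N0 T"
    have Es: "subgroup E G" unfolding E_def
      by (rule subgroups_Inter_pair[OF c(4) centralizer_mod_subgroup[OF N0 Tc]])
    have N0E: "N0 \<subseteq> E" using c(6) subset_centralizer_mod[OF N0 Tc] by (auto simp: E_def)
    have EN: "E \<subseteq> N" by (auto simp: E_def)
    have "h \<otimes> t \<otimes> inv h \<otimes> inv t \<in> N0" if t: "t \<in> T" for t
      using commutator_sym[OF N0s subgroup.mem_carrier[OF T(1) t] NmemC[OF h(1)] Th[OF t]] .
    then have hE: "h \<in> E" using h(1) NmemC[OF h(1)] by (auto simp: E_def centralizer_mod_def)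
    have "E \<lhd> G"
    proof (rule normal_if_supplement[OF c(4) M(1,4) Es chief_factor_subset_set_normalizer[OF sol ch Es N0E EN]])
      show "M \<subseteq> set_normalizer E"
      proof
        fix x assume x: "x \<in> M"
        note xc = MmemC[OF x]
        have inv_T: "inv x \<otimes> t \<otimes> x \<in> T" if t: "t \<in> T" for t
          using T(4)[OF subgroup.m_inv_closed[OF M(1) x] t] xc by simp
        show "x \<in> set_normalizer E"
          by (rule set_normalizerI[OF Es xc])
             (use normal_invE(2)[OF c(1) xc] centralizer_mod_conj[OF N0 Tc xc inv_T] in \<open>auto simp: E_def\<close>)
      qed
    qed
    then have "E = N" using c(7) N0E EN hE h(2) by blast
    have "T \<subseteq> C"
    proof
      fix t assume t: "t \<in> T"
      note tc = subgroup.mem_carrier[OF T(1) t]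
      have "t \<otimes> x \<otimes> inv t \<otimes> inv x \<in> N0" if x: "x \<in> N" for x
        by (rule commutator_sym[OF N0s NmemC[OF x] tc])
           (use x t \<open>E = N\<close> in \<open>auto simp: E_def centralizer_mod_def\<close>)
      then show "t \<in> C" using tc by (simp add: C_def centralizer_mod_def)
    qed
    then have "T = N0" using T(2,3) DN0 by (auto simp: D_def)
    then show False using T(6) pM by simp
  qed
qed

text \<open>Induction on |G| - |N| proves the property for every normal \<open>N\<close>.\<close>

lemma p_length_le_1_mod_one:
  assumes p: "prime p" and sol: "solvable G"
    and hyp: "\<And>M. maximal_subgroup M G \<Longrightarrow>
           prime_divisors_order (G\<lparr>carrier := M\<rparr>) = prime_divisors_order G \<Longrightarrow>
           supersolvable (G\<lparr>carrier := M\<rparr>)"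
  shows "p_length_le_1_mod p {\<one>}"
proof -
  have "N \<lhd> G \<Longrightarrow> p_length_le_1_mod p N" for N
  proof (induction "card (carrier G) - card N" arbitrary: N rule: less_induct)
    case less
    show ?case
    proof (rule p_length_le_1_mod_step[OF p sol hyp less.prems])
      fix K assume K: "K \<lhd> G" "N \<subset> K"
      note Ks = normal_imp_subgroup[OF K(1)]
      have "card N < card K" "card K \<le> card (carrier G)"
        using psubset_card_mono[OF finite_subgroup[OF Ks] K(2)]
          card_mono[OF finite_carrier subgroup.subset[OF Ks]] by auto
      then show "p_length_le_1_mod p K" using less.hyps[OF _ K(1)] by linarith
    qed
  qed
  then show ?thesis using one_is_normal by blast
qed

section \<open>From indices to the p-length\<close>

lemma section_group:
  assumes H: "H \<lhd> G" and K: "K \<lhd> G" "K \<subseteq> H"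
  shows "group (section_of G H K)" "order (section_of G H K) = idx H K"
proof -
  have Hs: "subgroup H G" using normal_imp_subgroup[OF H] .
  have "K \<lhd> G\<lparr>carrier := H\<rparr>"
    unfolding normal_nested_iff[OF Hs]
    using K normal_imp_subgroup[OF K(1)] normal_invE(2)[OF K(1) subgroup.mem_carrier[OF Hs]] by blast
  then show "group (section_of G H K)" by (rule normal.factorgroup_is_group)
  show "order (section_of G H K) = idx H K" using order_section[OF Hs normal_imp_subgroup[OF K(1)] K(2)] .
qed

text \<open>If all factors were p'-groups, then by induction along the series all its terms,
  including \<open>G\<close>, would have order prime to \<open>p\<close>.\<close>

lemma p_length_ge_1:
  assumes p: "prime p" "p dvd order G" and Hs: "p_series p G Hs"
  shows "card {i. Suc i < length Hs \<and> p_group p (series_factor G Hs i)} \<noteq> 0"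
proof
  assume "card {i. Suc i < length Hs \<and> p_group p (series_factor G Hs i)} = 0"
  moreover have "finite {i. Suc i < length Hs \<and> p_group p (series_factor G Hs i)}"
    by (rule finite_subset[of _ "{..<length Hs}"]) auto
  ultimately have "\<not> p_group p (series_factor G Hs i)" if "Suc i < length Hs" for i
    using that by auto
  then have p': "\<not> p dvd order (series_factor G Hs i)" if "Suc i < length Hs" for i
    using Hs that unfolding p_series_def p'_group_def by blast
  have ns: "Hs \<noteq> []" "hd Hs = {\<one>}" "last Hs = carrier G"
      "\<And>i. Suc i < length Hs \<Longrightarrow> Hs ! i \<subseteq> Hs ! Suc i" "\<And>i. i < length Hs \<Longrightarrow> Hs ! i \<lhd> G"
    using Hs by (auto simp: p_series_def normal_series_def)
  have "\<not> p dvd card (Hs ! i)" if "i < length Hs" for i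
    using that
  proof (induction i)
    case 0
    then show ?case using ns(1,2) p(1) not_prime_unit by (auto simp: hd_conv_nth)
  next
    case (Suc i)
    have H: "Hs ! i \<lhd> G" "Hs ! Suc i \<lhd> G" "Hs ! i \<subseteq> Hs ! Suc i" using ns Suc.prems by auto
    have "card (Hs ! Suc i) = idx (Hs ! Suc i) (Hs ! i) * card (Hs ! i)"
      using card_eq_idx[OF normal_imp_subgroup normal_imp_subgroup] H by blast
    moreover have "\<not> p dvd idx (Hs ! Suc i) (Hs ! i)"
      using p'[OF Suc.prems] section_group(2)[OF H(2,1,3)] by (simp add: series_factor_def)
    ultimately show ?case using Suc p(1) prime_dvd_mult_nat by auto
  qed
  then have "\<not> p dvd card (carrier G)" using ns(1,3) by (metis last_conv_nth length_greater_0_conv diff_less zero_less_one)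
  then show False using p(2) by (simp add: order_def)
qed

lemma p_length_eq_1:
  assumes p: "prime p" "p dvd order G" and le: "p_length_le_1_mod p {\<one>}"
  shows "p_length p G = 1"
proof -
  obtain A B k where a: "A \<lhd> G" "B \<lhd> G" "{\<one>} \<subseteq> A" "A \<subseteq> B"
      "\<not> p dvd idx A {\<one>}" "idx B A = p ^ k" "\<not> p dvd idx (carrier G) B"
    using le by (auto simp: p_length_le_1_mod_def)
  note As = normal_imp_subgroup[OF a(1)] and Bs = normal_imp_subgroup[OF a(2)]
  note triv = one_is_normal normal_imp_subgroup[OF one_is_normal]
  have Bc: "B \<subseteq> carrier G" using subgroup.subset[OF Bs] .
  have secs: "p'_group p (section_of G A {\<one>})" "p_group p (section_of G B A)"
    "p'_group p (section_of G (carrier G) B)"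
    using section_group[OF a(1) triv(1) a(3)] section_group[OF a(2,1,4)]
      section_group[OF normal_self a(2) Bc] a(5,6,7) by (auto simp: p_group_def p'_group_def)
  have notp: "\<not> p_group p (section_of G H K)"
    if HK: "H \<lhd> G" "K \<lhd> G" "K \<subset> H" "p'_group p (section_of G H K)" for H K
  proof
    assume "p_group p (section_of G H K)"
    then obtain j where "idx H K = p ^ j" using section_group(2)[OF HK(1,2)] HK(3) by (auto simp: p_group_def)
    moreover have "\<not> p dvd idx H K" using HK(3,4) section_group(2)[OF HK(1,2)] by (auto simp: p'_group_def)
    ultimately have "idx H K = 1" by (cases j) auto
    then show False using idx_gt_1[of H K] normal_imp_subgroup HK(1,2,3) by fastforce
  qed
  have notA: "\<not> p_group p (section_of G A {\<one>})" if "A \<noteq> {\<one>}"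
    using notp[OF a(1) triv(1) _ secs(1)] a(3) that by blast
  have notB: "\<not> p_group p (section_of G (carrier G) B)" if "B \<noteq> carrier G"
    using notp[OF normal_self a(2) _ secs(3)] Bc that by blast
  \<comment> \<open>A trivial outer factor would be counted as a \<open>p\<close>-group, so repeated
    terms at the two ends are dropped. Only the factor B/A is then counted, at position 0 or 1
    according to whether \<open>A\<close> was dropped.\<close>
  define Hs where "Hs = [{\<one>}] @ (if A = {\<one>} then [] else [A]) @ [B] @ (if B = carrier G then [] else [carrier G])"
  have less2: "Suc i < Suc (Suc 0) \<longleftrightarrow> i = 0" for i by auto
  have less3: "Suc i < Suc (Suc (Suc 0)) \<longleftrightarrow> i = 0 \<or> i = 1" for i by auto
  have less4: "Suc i < Suc (Suc (Suc (Suc 0))) \<longleftrightarrow> i = 0 \<or> i = 1 \<or> i = 2" for i by auto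
  have ns: "normal_series G Hs"
    unfolding normal_series_def Hs_def
    using a(1-4) triv Bc normal_self by (auto simp: less2 less3 less4 nth_Cons' split: if_splits)
  have ps: "p_series p G Hs"
    unfolding p_series_def using ns secs
    by (auto simp: Hs_def series_factor_def less2 less3 less4 nth_Cons' split: if_splits)
  have "\<exists>j. {i. Suc i < length Hs \<and> p_group p (series_factor G Hs i)} = {j}"
    using secs(2) notA notB
    by (auto simp: Hs_def series_factor_def less2 less3 less4 nth_Cons' split: if_splits intro: exI[of _ 0] exI[of _ 1])
  then have one: "1 = card {i. Suc i < length Hs \<and> p_group p (series_factor G Hs i)}" by auto
  show ?thesis
    unfolding p_length_def
  proof (rule Least_equality)
    show "\<exists>Hs. p_series p G Hs \<and> 1 = card {i. Suc i < length Hs \<and> p_group p (series_factor G Hs i)}"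
      using ps one by blast
    fix y assume "\<exists>Hs. p_series p G Hs \<and> y = card {i. Suc i < length Hs \<and> p_group p (series_factor G Hs i)}"
    then show "1 \<le> y" using p_length_ge_1[OF p] by (metis One_nat_def Suc_leI neq0_conv)
  qed
qed

end

theorem theoremC:
  fixes G :: "('a, 'b) monoid_scheme"
  assumes "group G" and "finite (carrier G)" and "solvable G"
    and "\<And>M. maximal_subgroup M G \<Longrightarrow>
           prime_divisors_order (G\<lparr>carrier := M\<rparr>) = prime_divisors_order G \<Longrightarrow>
           supersolvable (G\<lparr>carrier := M\<rparr>)"
  shows "\<forall>p \<in> prime_divisors_order G. p_length p G = 1"
proof -
  interpret finite_group G
    using assms(1,2) by (simp add: finite_group_def finite_group_axioms_def)
  show ?thesis
    using p_length_eq_1 p_length_le_1_mod_one[OF _ assms(3,4)] by (auto simp: prime_divisors_order_def)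
qed

end
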